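(* The C&CG-DRO(CG) algorithm described in the context converges to the global optimum of the two-stage distributionally robust problem $$w=\min_{\mathbf{x}}\ \Big\{\mathbf{c}^\intercal\mathbf{x}+\max_{\mathbb{P}\in\mathcal{P}}\mathbb{E}_{\mathbb{P}}[Q(\mathbf{x},\bm{\xi})]\ :\ \mathbf{A}\mathbf{x}\le\mathbf{b},\ \mathbf{x}\in\{0,1\}^{n_x}\times\mathbb{R}_+^{m_x}\Big\}$$ within $3^{m_\xi}\cdot S$ iterations.
   Context: **Data.** $\Xi=\prod_{i=1}^{m_\xi}[\underline{\xi}^i,\overline{\xi}^i]\subseteq\mathbb{R}^{m_\xi}$ is a box (the sample space), $\mathcal{F}$ is a $\sigma$-algebra of $\Xi$, and $\mathcal{M}(\Xi,\mathcal{F})$ is the set of all probability distributions on $(\Xi,\mathcal{F})$. The recourse function is $$Q(\mathbf{x},\bm{\xi})=\min_{\mathbf{y}\in\mathbb{R}_+^{m_y}}\{\mathbf{d}^\intercal\mathbf{y}:\ \mathbf{F}\mathbf{y}\le\mathbf{h}-\mathbf{G}\mathbf{x}-\mathbf{K}\bm{\xi}\},$$ with fixed real matrices and vectors of compatible sizes. The problem has relatively complete recourse: for all feasible first-stage $\mathbf{x}$ and all $\bm{\xi}\in\Xi$ the recourse problem is feasible and $|Q(\mathbf{x},\bm{\xi})|<\infty$. **Ambiguity set.** $\bm{\xi}_1^{\rm e},\dots,\bm{\xi}_S^{\rm e}$ are $S$ given samples of $\bm{\xi}$ with probabilities $\pi_s^{\rm e}$, $\sum_{s=1}^S\pi_s^{\rm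 e}=1$, and $\mathbb{P}^{\rm e}=\sum_{s=1}^S\pi_s^{\rm e}\delta_{\bm{\xi}_s^{\rm e}}$ is the empirical distribution. For a radius $r\ge0$, $\mathcal{P}=\{\mathbb{P}\in\mathcal{M}(\Xi,\mathcal{F}):\mathfrak{d}_{\rm w}(\mathbb{P},\mathbb{P}^{\rm e})\le r\}$, where $\mathfrak{d}_{\rm w}$ is the Wasserstein metric (minimum over couplings of the expected transport cost) with cost $\|\cdot\|_1$. Write $v(\mathbf{x})=\max_{\mathbb{P}\in\mathcal{P}}\mathbb{E}_{\mathbb{P}}[Q(\mathbf{x},\bm{\xi})]$ and $[S]=\{1,\dots,S\}$. **Inner column generation (CG) procedure for fixed first-stage $\hat{\mathbf{x}}$.** For each $s\in[S]$ a set $\Omega_s$ of scenarios is maintained (some given scenarios at the start; empty at the start in the convergence analysis). Each CG iteration does the following. (1) Solve the pricing master problem: maximise $\sum_{s=1}^S\sum_{\bm{\xi}_s\in\Omega_s}\pi_s^{\rm e}Q(\hat{\mathbf{x}},\bm{\xi}_s)\pi_{\bm{\xi}_s}$ over $\pi_{\bm{\xi}_s}\ge0$ subject to $\sum_{\bm{\xi}_s\in\Omega_s}\pi_{\bm{\xi}_s}=1$ for all $s$ (multipliers $\alpha_s\in\mathbb{R}$) and $\sum_{s=1}^S\pi_s^{\rm e}\sum_{\bm{\xi}_s\in\Omega_s}\|\bm{\xi}_s-\bm{\xi}_s^{\rm e}\|_1\pi_{\bm{\xi}_s}\le r$ (multiplier $\beta\ge0$), and take optimal multipliers $\hat\alpha_s,\hat\beta$.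 (2) For each $s$ compute $\mu_s=\max_{\bm{\xi}_s\in\Xi}\ \pi_s^{\rm e}(Q(\hat{\mathbf{x}},\bm{\xi}_s)-\hat\beta\|\bm{\xi}_s-\bm{\xi}_s^{\rm e}\|_1)-\hat\alpha_s$, via an equivalent mixed-integer linear form in which the optimal scenario $\hat{\bm{\xi}}_s$ has components $\hat\xi_s^i\in\{\overline{\xi}^i,\underline{\xi}^i,\xi_s^{{\rm e},i}\}$ (an optimal solution of this form exists). (3) If $\mu_s\le0$ for all $s$, stop; otherwise add $\hat{\bm{\xi}}_{s'}$ to $\Omega_{s'}$ for $s'$ with $\mu_{s'}>0$ and repeat. CG converges finitely to the value $v(\hat{\mathbf{x}})$; the scenario sets obtained at termination are denoted $\widehat\Omega_s(\hat{\mathbf{x}})$, $s\in[S]$. **Outer algorithm C&CG-DRO(CG).** For each $s\in[S]$, $\Upsilon_s$ is the set of scenarios generated up to the current iteration; in the convergence analysis $\Upsilon_s=\emptyset$ at initialisation. Initially $\mathrm{UB}=+\infty$. Each (outer) iteration does the following. 1. Solve the main master problem $$\underline{w}=\min\ \mathbf{c}^\intercal\mathbf{x}+\eta$$ over $\mathbf{x}\in\{0,1\}^{n_x}\times\mathbb{R}_+^{m_x}$, $\eta\in\mathbb{R}$, $\alpha_s\in\mathbb{R}$ ($s\in[S]$), $\beta\ge0$, and $\eta_{\bm{\xi}_s}\in\mathbb{R}$, $\mathbf{y}_{\bm{\xi}_s}\in\mathbb{R}_+^{m_y}$ ($\bm{\xi}_s\in\Upsilon_s$, $s\in[S]$), subject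 to $\mathbf{A}\mathbf{x}\le\mathbf{b}$, $\eta\ge\sum_{s=1}^S\alpha_s+r\beta$ and, for all $s\in[S]$ and $\bm{\xi}_s\in\Upsilon_s$: $\alpha_s+\pi_s^{\rm e}\|\bm{\xi}_s-\bm{\xi}_s^{\rm e}\|_1\beta\ge\pi_s^{\rm e}\eta_{\bm{\xi}_s}$, $\ \eta_{\bm{\xi}_s}=\mathbf{d}^\intercal\mathbf{y}_{\bm{\xi}_s}$, $\ \mathbf{F}\mathbf{y}_{\bm{\xi}_s}\le\mathbf{h}-\mathbf{G}\mathbf{x}-\mathbf{K}\bm{\xi}_s$. Let $\hat{\mathbf{x}}$ be an optimal first-stage solution and set $\mathrm{LB}=\underline{w}\ (\le w)$. 2. Run the inner CG procedure for $\hat{\mathbf{x}}$, obtaining $v(\hat{\mathbf{x}})$ and $\widehat\Omega_s(\hat{\mathbf{x}})$; set $\mathrm{UB}\leftarrow\min\{\mathrm{UB},\ \mathbf{c}^\intercal\hat{\mathbf{x}}+v(\hat{\mathbf{x}})\}\ (\ge w)$ and $\Upsilon_s\leftarrow\Upsilon_s\cup\widehat\Omega_s(\hat{\mathbf{x}})$ for each $s\in[S]$, which adds the corresponding variables and constraints to the main master problem. 3. Stop when the relative gap $(\mathrm{UB}-\mathrm{LB})/|\mathrm{LB}|$ falls below a pre-defined tolerance $\varepsilon\ge0$ (the convergence analysis takes $\varepsilon=0$); otherwise go to the next iteration.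
   Formalization: For S = 1 the bound does not count the opening iteration, where all scenario sets are empty and the main master problem is unbounded (any feasible x may be taken); counting it, 3^m+1 iterations can occur. For S ≥ 2 all iterations are counted. *)

theory Defs
  imports "HOL-Probability.Probability"
begin

text \<open>
  Index types: \<open>'n\<close> first-stage variables, \<open>'m\<close> components of the uncertain vector,
  \<open>'y\<close> recourse variables, \<open>'p\<close> first-stage constraints, \<open>'q\<close> recourse constraints,
  \<open>'s\<close> samples. The first-stage variables with index in \<open>bin\<close> are the binary ones and
  the others are the continuous ones, so that the purely binary and the purely continuous
  cases are included.
\<close>

record ('n, 'm, 'y, 'p, 'q, 's) dro =
  lo :: "real ^ 'm::finite"
  hi :: "real ^ 'm::finite"
  salg :: "(real ^ 'm::finite) set set"
  bin :: "('n::finite) set"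
  cvec :: "real ^ 'n::finite"
  Amat :: "real ^ 'n::finite ^ 'p::finite"
  bvec :: "real ^ 'p::finite"
  dvec :: "real ^ 'y::finite"
  Fmat :: "real ^ 'y::finite ^ 'q::finite"
  hvec :: "real ^ 'q::finite"
  Gmat :: "real ^ 'n::finite ^ 'q::finite"
  Kmat :: "real ^ 'm::finite ^ 'q::finite"
  smp :: "'s::finite \<Rightarrow> real ^ 'm::finite"
  prb :: "'s::finite \<Rightarrow> real"
  radius :: real

definition l1 :: "real ^ 'm::finite \<Rightarrow> real" where
  "l1 u = (\<Sum>i\<in>UNIV. \<bar>u $ i\<bar>)"

definition Xi :: "('n::finite, 'm::finite, 'y::finite, 'p::finite, 'q::finite, 's::finite) dro
    \<Rightarrow> (real ^ 'm) set" where
  "Xi D = {\<xi>. lo D \<le> \<xi> \<and> \<xi> \<le> hi D}"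

definition first_stage :: "('n::finite, 'm::finite, 'y::finite, 'p::finite, 'q::finite, 's::finite) dro
    \<Rightarrow> (real ^ 'n) set" where
  "first_stage D = {x. Amat D *v x \<le> bvec D \<and>
     (\<forall>j\<in>bin D. x $ j \<in> {0, 1}) \<and> (\<forall>j\<in>- bin D. 0 \<le> x $ j)}"

definition recourse :: "('n::finite, 'm::finite, 'y::finite, 'p::finite, 'q::finite, 's::finite) dro
    \<Rightarrow> real ^ 'n \<Rightarrow> real ^ 'm \<Rightarrow> (real ^ 'y) set" where
  "recourse D x \<xi> = {y. 0 \<le> y \<and> Fmat D *v y \<le> hvec D - Gmat D *v x - Kmat D *v \<xi>}"

definition Q :: "('n::finite, 'm::finite, 'y::finite, 'p::finite, 'q::finite, 's::finite) dro
    \<Rightarrow> real ^ 'n \<Rightarrow> real ^ 'm \<Rightarrow> real" where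
  "Q D x \<xi> = (INF y\<in>recourse D x \<xi>. dvec D \<bullet> y)"

text \<open>The real infimum in \<open>Q\<close> is meaningful exactly when the recourse problem is
  feasible and bounded, which is what the next condition requires.\<close>

definition relatively_complete_recourse ::
    "('n::finite, 'm::finite, 'y::finite, 'p::finite, 'q::finite, 's::finite) dro \<Rightarrow> bool" where
  "relatively_complete_recourse D \<longleftrightarrow> (\<forall>x\<in>first_stage D. \<forall>\<xi>\<in>Xi D.
     recourse D x \<xi> \<noteq> {} \<and> bdd_below ((\<lambda>y. dvec D \<bullet> y) ` recourse D x \<xi>))"

definition distributions :: "('n::finite, 'm::finite, 'y::finite, 'p::finite, 'q::finite, 's::finite) dro
    \<Rightarrow> (real ^ 'm) measure set" where
  "distributions D = {P. prob_space P \<and> space P = Xi D \<and> sets P = salg D}"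

definition empirical :: "('n::finite, 'm::finite, 'y::finite, 'p::finite, 'q::finite, 's::finite) dro
    \<Rightarrow> (real ^ 'm) measure" where
  "empirical D = measure_of (Xi D) (salg D)
     (\<lambda>E. \<Sum>s\<in>UNIV. ennreal (prb D s) * indicator E (smp D s))"

definition couplings :: "'a measure \<Rightarrow> 'a measure \<Rightarrow> ('a \<times> 'a) measure set" where
  "couplings P P' = {\<gamma>. sets \<gamma> = sets (P \<Otimes>\<^sub>M P') \<and> distr \<gamma> P fst = P \<and> distr \<gamma> P' snd = P'}"

definition wasserstein :: "(real ^ 'm::finite) measure \<Rightarrow> (real ^ 'm) measure \<Rightarrow> ennreal" where
  "wasserstein P P' = (INF \<gamma>\<in>couplings P P'. \<integral>\<^sup>+z. ennreal (l1 (fst z - snd z)) \<partial>\<gamma>)"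

definition ambiguity :: "('n::finite, 'm::finite, 'y::finite, 'p::finite, 'q::finite, 's::finite) dro
    \<Rightarrow> (real ^ 'm) measure set" where
  "ambiguity D = {P \<in> distributions D. wasserstein P (empirical D) \<le> ennreal (radius D)}"

definition v :: "('n::finite, 'm::finite, 'y::finite, 'p::finite, 'q::finite, 's::finite) dro
    \<Rightarrow> real ^ 'n \<Rightarrow> real" where
  "v D x = (SUP P\<in>ambiguity D. \<integral>\<xi>. Q D x \<xi> \<partial>P)"

definition total_cost :: "('n::finite, 'm::finite, 'y::finite, 'p::finite, 'q::finite, 's::finite) dro
    \<Rightarrow> real ^ 'n \<Rightarrow> real" where
  "total_cost D x = cvec D \<bullet> x + v D x"

definition opt_value :: "('n::finite, 'm::finite, 'y::finite, 'p::finite, 'q::finite, 's::finite) dro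
    \<Rightarrow> real" where
  "opt_value D = (INF x\<in>first_stage D. total_cost D x)"

definition global_optimum :: "('n::finite, 'm::finite, 'y::finite, 'p::finite, 'q::finite, 's::finite) dro
    \<Rightarrow> real ^ 'n \<Rightarrow> bool" where
  "global_optimum D x \<longleftrightarrow> x \<in> first_stage D \<and> (\<forall>x'\<in>first_stage D. total_cost D x \<le> total_cost D x')"

definition pricing_master_feasible ::
    "('n::finite, 'm::finite, 'y::finite, 'p::finite, 'q::finite, 's::finite) dro
     \<Rightarrow> ('s \<Rightarrow> (real ^ 'm) set) \<Rightarrow> ('s \<Rightarrow> real ^ 'm \<Rightarrow> real) \<Rightarrow> bool" where
  "pricing_master_feasible D \<Omega> p \<longleftrightarrow>
     (\<forall>s. \<forall>\<xi>\<in>\<Omega> s. 0 \<le> p s \<xi>) \<and>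
     (\<forall>s. (\<Sum>\<xi>\<in>\<Omega> s. p s \<xi>) = 1) \<and>
     (\<Sum>s\<in>UNIV. prb D s * (\<Sum>\<xi>\<in>\<Omega> s. l1 (\<xi> - smp D s) * p s \<xi>)) \<le> radius D"

definition pricing_master_value ::
    "('n::finite, 'm::finite, 'y::finite, 'p::finite, 'q::finite, 's::finite) dro
     \<Rightarrow> real ^ 'n \<Rightarrow> ('s \<Rightarrow> (real ^ 'm) set) \<Rightarrow> real" where
  "pricing_master_value D x \<Omega> =
     (SUP p\<in>{p. pricing_master_feasible D \<Omega> p}. \<Sum>s\<in>UNIV. \<Sum>\<xi>\<in>\<Omega> s. prb D s * Q D x \<xi> * p s \<xi>)"

definition multipliers_feasible ::
    "('n::finite, 'm::finite, 'y::finite, 'p::finite, 'q::finite, 's::finite) dro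
     \<Rightarrow> real ^ 'n \<Rightarrow> ('s \<Rightarrow> (real ^ 'm) set) \<Rightarrow> ('s \<Rightarrow> real) \<Rightarrow> real \<Rightarrow> bool" where
  "multipliers_feasible D x \<Omega> \<alpha> \<beta> \<longleftrightarrow> 0 \<le> \<beta> \<and>
     (\<forall>s. \<forall>\<xi>\<in>\<Omega> s. prb D s * Q D x \<xi> \<le> \<alpha> s + prb D s * l1 (\<xi> - smp D s) * \<beta>)"

text \<open>Optimal solutions of the linear programming dual of the pricing master problem.\<close>

definition multipliers_optimal ::
    "('n::finite, 'm::finite, 'y::finite, 'p::finite, 'q::finite, 's::finite) dro
     \<Rightarrow> real ^ 'n \<Rightarrow> ('s \<Rightarrow> (real ^ 'm) set) \<Rightarrow> ('s \<Rightarrow> real) \<Rightarrow> real \<Rightarrow> bool" where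
  "multipliers_optimal D x \<Omega> \<alpha> \<beta> \<longleftrightarrow> multipliers_feasible D x \<Omega> \<alpha> \<beta> \<and>
     (\<forall>\<alpha>' \<beta>'. multipliers_feasible D x \<Omega> \<alpha>' \<beta>' \<longrightarrow>
        (\<Sum>s\<in>UNIV. \<alpha> s) + radius D * \<beta> \<le> (\<Sum>s\<in>UNIV. \<alpha>' s) + radius D * \<beta>')"

definition reduced_cost ::
    "('n::finite, 'm::finite, 'y::finite, 'p::finite, 'q::finite, 's::finite) dro
     \<Rightarrow> real ^ 'n \<Rightarrow> ('s \<Rightarrow> real) \<Rightarrow> real \<Rightarrow> 's \<Rightarrow> real ^ 'm \<Rightarrow> real" where
  "reduced_cost D x \<alpha> \<beta> s \<xi> = prb D s * (Q D x \<xi> - \<beta> * l1 (\<xi> - smp D s)) - \<alpha> s"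

definition candidates :: "('n::finite, 'm::finite, 'y::finite, 'p::finite, 'q::finite, 's::finite) dro
    \<Rightarrow> 's \<Rightarrow> (real ^ 'm) set" where
  "candidates D s = {\<xi>. \<forall>i. \<xi> $ i \<in> {hi D $ i, lo D $ i, smp D s $ i}}"

text \<open>The pricing subproblem of sample \<open>s\<close> is over the whole box; only the solution \<open>z s\<close> taken
  from it is required to be a candidate. Its optimal value is \<open>reduced_cost D x \<alpha> \<beta> s (z s)\<close>.\<close>

definition cg_priced ::
    "('n::finite, 'm::finite, 'y::finite, 'p::finite, 'q::finite, 's::finite) dro
     \<Rightarrow> real ^ 'n \<Rightarrow> ('s \<Rightarrow> (real ^ 'm) set) \<Rightarrow> ('s \<Rightarrow> real) \<Rightarrow> real \<Rightarrow> ('s \<Rightarrow> real ^ 'm) \<Rightarrow> bool" where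
  "cg_priced D x \<Omega> \<alpha> \<beta> z \<longleftrightarrow>
     (\<exists>p. pricing_master_feasible D \<Omega> p) \<and> multipliers_optimal D x \<Omega> \<alpha> \<beta> \<and>
     (\<forall>s. z s \<in> candidates D s \<and>
        is_arg_max (reduced_cost D x \<alpha> \<beta> s) (\<lambda>\<xi>. \<xi> \<in> Xi D) (z s))"

text \<open>As long as the pricing master problem is infeasible (as it is for empty scenario sets)
  it has no optimal multipliers. Rule \<open>phase1\<close> leaves open how scenarios are then found (samples
  as starting scenarios, Farkas pricing, penalties): it only asks for new
  scenarios among the candidates.\<close>

inductive cg_step ::
    "('n::finite, 'm::finite, 'y::finite, 'p::finite, 'q::finite, 's::finite) dro
     \<Rightarrow> real ^ 'n \<Rightarrow> ('s \<Rightarrow> (real ^ 'm) set) \<Rightarrow> ('s \<Rightarrow> (real ^ 'm) set) \<Rightarrow> bool"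
  for D x where
  phase1: "\<lbrakk>\<nexists>p. pricing_master_feasible D \<Omega> p; \<And>s. \<Omega> s \<subseteq> \<Omega>' s; \<And>s. \<Omega>' s \<subseteq> candidates D s; \<Omega>' \<noteq> \<Omega>\<rbrakk>
     \<Longrightarrow> cg_step D x \<Omega> \<Omega>'"
| price: "\<lbrakk>cg_priced D x \<Omega> \<alpha> \<beta> z; \<exists>s. 0 < reduced_cost D x \<alpha> \<beta> s (z s)\<rbrakk>
     \<Longrightarrow> cg_step D x \<Omega> (\<lambda>s. if 0 < reduced_cost D x \<alpha> \<beta> s (z s) then insert (z s) (\<Omega> s) else \<Omega> s)"

definition cg_stop ::
    "('n::finite, 'm::finite, 'y::finite, 'p::finite, 'q::finite, 's::finite) dro
     \<Rightarrow> real ^ 'n \<Rightarrow> ('s \<Rightarrow> (real ^ 'm) set) \<Rightarrow> bool" where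
  "cg_stop D x \<Omega> \<longleftrightarrow> (\<exists>\<alpha> \<beta> z. cg_priced D x \<Omega> \<alpha> \<beta> z \<and> (\<forall>s. reduced_cost D x \<alpha> \<beta> s (z s) \<le> 0))"

definition cg_reaches ::
    "('n::finite, 'm::finite, 'y::finite, 'p::finite, 'q::finite, 's::finite) dro
     \<Rightarrow> real ^ 'n \<Rightarrow> ('s \<Rightarrow> (real ^ 'm) set) \<Rightarrow> bool" where
  "cg_reaches D x \<Omega> \<longleftrightarrow> (cg_step D x)\<^sup>*\<^sup>* (\<lambda>s. {}) \<Omega>"

definition cg_converges ::
    "('n::finite, 'm::finite, 'y::finite, 'p::finite, 'q::finite, 's::finite) dro
     \<Rightarrow> real ^ 'n \<Rightarrow> bool" where
  "cg_converges D x \<longleftrightarrow>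
     (\<forall>\<Omega>. cg_reaches D x \<Omega> \<longrightarrow> cg_stop D x \<Omega> \<or> (\<exists>\<Omega>'. cg_step D x \<Omega> \<Omega>')) \<and>
     (\<nexists>\<omega>. \<omega> 0 = (\<lambda>s. {}) \<and> (\<forall>k::nat. cg_step D x (\<omega> k) (\<omega> (Suc k)))) \<and>
     (\<forall>\<Omega>. cg_reaches D x \<Omega> \<and> cg_stop D x \<Omega> \<longrightarrow> pricing_master_value D x \<Omega> = v D x)"

definition main_master_feasible ::
    "('n::finite, 'm::finite, 'y::finite, 'p::finite, 'q::finite, 's::finite) dro
     \<Rightarrow> ('s \<Rightarrow> (real ^ 'm) set) \<Rightarrow> real ^ 'n \<Rightarrow> real \<Rightarrow> ('s \<Rightarrow> real) \<Rightarrow> real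
     \<Rightarrow> ('s \<Rightarrow> real ^ 'm \<Rightarrow> real) \<Rightarrow> ('s \<Rightarrow> real ^ 'm \<Rightarrow> real ^ 'y) \<Rightarrow> bool" where
  "main_master_feasible D \<Upsilon> x \<eta> \<alpha> \<beta> e y \<longleftrightarrow>
     x \<in> first_stage D \<and> 0 \<le> \<beta> \<and> (\<Sum>s\<in>UNIV. \<alpha> s) + radius D * \<beta> \<le> \<eta> \<and>
     (\<forall>s. \<forall>\<xi>\<in>\<Upsilon> s.
        prb D s * e s \<xi> \<le> \<alpha> s + prb D s * l1 (\<xi> - smp D s) * \<beta> \<and>
        e s \<xi> = dvec D \<bullet> y s \<xi> \<and> y s \<xi> \<in> recourse D x \<xi>)"

definition main_master_optimal ::
    "('n::finite, 'm::finite, 'y::finite, 'p::finite, 'q::finite, 's::finite) dro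
     \<Rightarrow> ('s \<Rightarrow> (real ^ 'm) set) \<Rightarrow> real ^ 'n \<Rightarrow> real \<Rightarrow> bool" where
  "main_master_optimal D \<Upsilon> x w \<longleftrightarrow>
     (\<exists>\<eta> \<alpha> \<beta> e y. main_master_feasible D \<Upsilon> x \<eta> \<alpha> \<beta> e y \<and> w = cvec D \<bullet> x + \<eta>) \<and>
     (\<forall>x' \<eta>' \<alpha>' \<beta>' e' y'. main_master_feasible D \<Upsilon> x' \<eta>' \<alpha>' \<beta>' e' y' \<longrightarrow> w \<le> cvec D \<bullet> x' + \<eta>')"

definition main_master_unbounded ::
    "('n::finite, 'm::finite, 'y::finite, 'p::finite, 'q::finite, 's::finite) dro
     \<Rightarrow> ('s \<Rightarrow> (real ^ 'm) set) \<Rightarrow> bool" where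
  "main_master_unbounded D \<Upsilon> \<longleftrightarrow>
     (\<forall>B. \<exists>x \<eta> \<alpha> \<beta> e y. main_master_feasible D \<Upsilon> x \<eta> \<alpha> \<beta> e y \<and> cvec D \<bullet> x + \<eta> < B)"

text \<open>With empty scenario sets nothing bounds \<open>\<alpha>\<close> from below, and the main master problem
  is unbounded. It then yields the trivial lower bound and any feasible first-stage
  solution may be taken.\<close>

inductive solve_main_master ::
    "('n::finite, 'm::finite, 'y::finite, 'p::finite, 'q::finite, 's::finite) dro
     \<Rightarrow> ('s \<Rightarrow> (real ^ 'm) set) \<Rightarrow> real ^ 'n \<Rightarrow> ereal \<Rightarrow> bool"
  for D \<Upsilon> where
  optimal: "main_master_optimal D \<Upsilon> x w \<Longrightarrow> solve_main_master D \<Upsilon> x (ereal w)"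
| unbounded: "\<lbrakk>main_master_unbounded D \<Upsilon>; x \<in> first_stage D\<rbrakk> \<Longrightarrow> solve_main_master D \<Upsilon> x (-\<infinity>)"

record ('n, 'm, 's) ccg_state =
  scenarios :: "'s \<Rightarrow> (real ^ 'm::finite) set"
  LB :: ereal
  UB :: ereal
  incumbent :: "(real ^ 'n::finite) option"

definition initial_state :: "('n::finite, 'm::finite, 's) ccg_state" where
  "initial_state = \<lparr>scenarios = (\<lambda>s. {}), LB = -\<infinity>, UB = \<infinity>, incumbent = None\<rparr>"

text \<open>The incumbent is the first-stage solution at which the current upper bound was found;
  it need not be the last first-stage solution.\<close>

inductive ccg_iteration ::
    "('n::finite, 'm::finite, 'y::finite, 'p::finite, 'q::finite, 's::finite) dro
     \<Rightarrow> ('n, 'm, 's) ccg_state \<Rightarrow> ('n, 'm, 's) ccg_state \<Rightarrow> bool"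
  for D where
  "\<lbrakk>solve_main_master D (scenarios st) x lb;
    cg_reaches D x \<Omega>; cg_stop D x \<Omega>;
    u = ereal (cvec D \<bullet> x + pricing_master_value D x \<Omega>)\<rbrakk>
   \<Longrightarrow> ccg_iteration D st
        \<lparr>scenarios = (\<lambda>s. scenarios st s \<union> \<Omega> s), LB = lb, UB = min (UB st) u,
         incumbent = (if u < UB st then Some x else incumbent st)\<rparr>"

text \<open>In \<^typ>\<open>ereal\<close>, \<open>g / 0 = \<infinity>\<close> for \<open>g > 0\<close> and \<open>0 / 0 = 0\<close>, so the formula below
  is right for \<open>LB = 0\<close>. But \<open>\<infinity> / \<infinity> = 0\<close>, so \<open>LB = -\<infinity>\<close> has to be excluded.\<close>

definition ccg_stop :: "real \<Rightarrow> ('n::finite, 'm::finite, 's) ccg_state \<Rightarrow> bool" where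
  "ccg_stop \<epsilon> st \<longleftrightarrow> LB st \<noteq> -\<infinity> \<and> (UB st - LB st) / \<bar>LB st\<bar> \<le> ereal \<epsilon>"

text \<open>\<open>ccg_after D \<epsilon> k st\<close>: some execution with tolerance \<open>\<epsilon>\<close> is in state \<open>st\<close> after
  iteration \<open>k\<close>. Iteration \<open>0\<close> is the opening pass on empty scenario sets, in which the
  main master problem has no optimal solution.\<close>

inductive ccg_after ::
    "('n::finite, 'm::finite, 'y::finite, 'p::finite, 'q::finite, 's::finite) dro
     \<Rightarrow> real \<Rightarrow> nat \<Rightarrow> ('n, 'm, 's) ccg_state \<Rightarrow> bool"
  for D \<epsilon> where
  first: "ccg_iteration D initial_state st \<Longrightarrow> ccg_after D \<epsilon> 0 st"
| further: "\<lbrakk>ccg_after D \<epsilon> k st; \<not> ccg_stop \<epsilon> st; ccg_iteration D st st'\<rbrakk>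
     \<Longrightarrow> ccg_after D \<epsilon> (Suc k) st'"

end

theory Submission
  imports Defs "HOL-Library.Function_Algebras"
begin

text \<open>
  The algorithm stops because only finitely many scenarios can ever be generated, and it stops
  at an optimum because the inner procedure is exact.

  The function \<open>Q D x\<close> is convex in the scenario, and on either side of a sample coordinate the
  transport penalty is affine in that coordinate. A penalised recourse cost can therefore be pushed, one
  coordinate at a time, to an end of the box or to the sample coordinate without losing value
  (\<open>candidate_dominates\<close>), so that pricing over the box is pricing over at most \<open>3 ^ CARD('m)\<close>
  candidates per sample.

  The pricing master problem and its multipliers are dual linear programs without a gap
  (\<open>strong_duality\<close>). A solution of the former is a discrete distribution together with a transport
  plan from the samples, and so a member of the ambiguity set (\<open>mixture_in_ambiguity\<close>). Multipliers that
  satisfy their constraints on the whole box bound the expected recourse cost under every member of the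
  ambiguity set (\<open>expectation_le_dual_value\<close>). When no scenario has positive reduced cost, the current
  multipliers are of this kind, and the two bounds meet in \<open>v D x\<close> (\<open>cg_stop_certificate\<close>).

  If the inner procedure for the current first-stage solution \<open>x\<close> ends with scenarios that the main
  master problem already contained, then weak duality makes the master value at \<open>x\<close> at least
  the total cost of \<open>x\<close>, and the two bounds of the outer algorithm meet
  (\<open>ccg_iteration_sound\<close>). Hence every iteration after the opening pass that does not end the algorithm
  contributes a scenario. The opening pass leaves at least one scenario for each sample, which gives
  the bound on the number of iterations (\<open>ccg_after_invariant\<close>).

  What remains is that the main master problem has an optimal solution. A feasible linear program attains
  its minimum unless its recession cone contains a direction of descent (\<open>linear_program_attains\<close>). The
  recession cone of the recourse problem is the same for all scenarios. So a direction of descent of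
  the master problem, averaged over a feasible solution of the pricing master problem, gives a ray of
  first-stage solutions along which the total cost is unbounded below
  (\<open>master_direction_cost_nonneg\<close>), which the lower bound on the total cost excludes.
\<close>

section \<open>Attainment in linear programs\<close>

text \<open>The recourse decisions in the main master problem are indexed by samples and scenarios. With
  functions as vectors, this problem is a linear program over a product of vector spaces.\<close>

instantiation "fun" :: (type, real_vector) real_vector
begin

definition scaleR_fun :: "real \<Rightarrow> ('a \<Rightarrow> 'b) \<Rightarrow> 'a \<Rightarrow> 'b" where
  "scaleR_fun r f = (\<lambda>x. r *\<^sub>R f x)"

instance
  by standard (simp_all add: scaleR_fun_def fun_eq_iff scaleR_add_right scaleR_add_left)

end

lemma scaleR_fun_apply [simp]: "(r *\<^sub>R f) x = r *\<^sub>R f x"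
  by (simp add: scaleR_fun_def)

text \<open>A polyhedron \<open>S\<close> together with the recession cone \<open>R\<close> of the same inequalities. The cone is
  a second argument because it depends on the inequalities and not only on \<open>S\<close> when \<open>S\<close> is empty.\<close>

definition polyhedral :: "'a::real_vector set \<Rightarrow> 'a set \<Rightarrow> bool" where
  "polyhedral S R \<longleftrightarrow> (\<exists>C :: (('a \<Rightarrow> real) \<times> real) set. finite C \<and> (\<forall>(f, b)\<in>C. linear f) \<and>
     S = {x. \<forall>(f, b)\<in>C. f x \<le> (b::real)} \<and> R = {u. \<forall>(f, b)\<in>C. f u \<le> 0})"

lemma polyhedralE:
  fixes S :: "'a::real_vector set"
  assumes "polyhedral S R"
  obtains C :: "(('a \<Rightarrow> real) \<times> real) set" where "finite C" "\<forall>(f, b)\<in>C. linear f"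
    "S = {x. \<forall>(f, b)\<in>C. f x \<le> (b::real)}" "R = {u. \<forall>(f, b)\<in>C. f u \<le> 0}"
  using assms unfolding polyhedral_def by (elim exE conjE) (rule that)

lemma polyhedral_le:
  fixes f :: "'a::real_vector \<Rightarrow> real"
  assumes "linear f" "linear g"
  shows "polyhedral {x. f x \<le> g x + b} {u. f u \<le> g u}"
proof -
  have "linear (\<lambda>x. f x - g x)"
    using assms by (rule linear_compose_sub)
  then show ?thesis
    unfolding polyhedral_def
    by (intro exI[of _ "{(\<lambda>x. f x - g x, b)}"]) (auto simp: algebra_simps)
qed

lemma polyhedral_const_le:
  fixes f :: "'a::real_vector \<Rightarrow> real"
  assumes "linear f"
  shows "polyhedral {x. f x \<le> b} {u. f u \<le> 0}"
  using polyhedral_le[OF assms linear_zero, of b] by simp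

lemma polyhedral_Int:
  fixes S :: "'a::real_vector set"
  assumes "polyhedral S R" "polyhedral S' R'"
  shows "polyhedral (S \<inter> S') (R \<inter> R')"
proof -
  obtain C :: "(('a \<Rightarrow> real) \<times> real) set" where C: "finite C" "\<forall>(f, b)\<in>C. linear f"
    "S = {x. \<forall>(f, b)\<in>C. f x \<le> (b::real)}" "R = {u. \<forall>(f, b)\<in>C. f u \<le> 0}"
    using assms(1) by (rule polyhedralE)
  obtain C' :: "(('a \<Rightarrow> real) \<times> real) set" where C': "finite C'" "\<forall>(f, b)\<in>C'. linear f"
    "S' = {x. \<forall>(f, b)\<in>C'. f x \<le> (b::real)}" "R' = {u. \<forall>(f, b)\<in>C'. f u \<le> 0}"
    using assms(2) by (rule polyhedralE)
  have "\<forall>(f, b)\<in>C \<union> C'. linear f" using C(2) C'(2) by blast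
  then show ?thesis
    unfolding polyhedral_def C(3,4) C'(3,4)
    by (intro exI[of _ "C \<union> C'"] conjI finite_UnI C(1) C'(1)) blast+
qed

lemma polyhedral_INT:
  assumes "finite I" "\<And>i. i \<in> I \<Longrightarrow> polyhedral (S i) (R i)"
  shows "polyhedral (\<Inter>i\<in>I. S i) (\<Inter>i\<in>I. R i)"
  using assms
proof (induction I rule: finite_induct)
  case empty
  show ?case
    unfolding polyhedral_def by (intro exI[of _ "{}"]) auto
next
  case (insert i I)
  then show ?case
    by (auto intro: polyhedral_Int)
qed

lemma polyhedral_vec_le:
  fixes f g :: "'a::real_vector \<Rightarrow> real ^ 'k::finite"
  assumes "linear f" "linear g"
  shows "polyhedral {x. f x \<le> g x + b} {u. f u \<le> g u}"
proof -
  have "polyhedral {x. f x $ i \<le> g x $ i + b $ i} {u. f u $ i \<le> g u $ i}" for i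
    by (intro polyhedral_le linear_compose[OF assms(1), unfolded o_def, of "\<lambda>v. v $ i"]
        linear_compose[OF assms(2), unfolded o_def, of "\<lambda>v. v $ i"] linearI) simp_all
  then have "polyhedral (\<Inter>i\<in>UNIV. {x. f x $ i \<le> g x $ i + b $ i}) (\<Inter>i\<in>UNIV. {u. f u $ i \<le> g u $ i})"
    by (intro polyhedral_INT) auto
  then show ?thesis
    by (simp add: less_eq_vec_def Collect_all_eq)
qed

lemma polyhedral_recession:
  fixes S :: "'a::real_vector set"
  assumes "polyhedral S R" "x \<in> S" "u \<in> R" "0 \<le> t"
  shows "x + t *\<^sub>R u \<in> S"
proof -
  obtain C :: "(('a \<Rightarrow> real) \<times> real) set" where C: "finite C" "\<forall>(f, b)\<in>C. linear f"
    "S = {x. \<forall>(f, b)\<in>C. f x \<le> (b::real)}" "R = {u. \<forall>(f, b)\<in>C. f u \<le> 0}"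
    using assms(1) by (rule polyhedralE)
  have "f (x + t *\<^sub>R u) \<le> b" if "(f, b) \<in> C" for f b
  proof -
    have "linear f" "f x \<le> b" "f u \<le> 0"
      using C assms that by auto
    then show ?thesis
      using mult_nonneg_nonpos[of t "f u"] assms(4) by (simp add: linear_add linear_scale)
  qed
  then show ?thesis
    using C by auto
qed

text \<open>From any feasible point one can walk, without increasing the objective and making a
  further constraint tight at each turn, to a point where the objective is constant on the affine space
  cut out by the tight constraints. At such points the set of tight constraints determines the
  objective value, so they take only finitely many values.\<close>

lemma linear_program_attains:
  fixes c :: "'a::real_vector \<Rightarrow> real"
  assumes poly: "polyhedral S R" and ne: "S \<noteq> {}" and c: "linear c"
    and rec: "\<And>u. u \<in> R \<Longrightarrow> 0 \<le> c u"
  shows "\<exists>x\<in>S. \<forall>x'\<in>S. c x \<le> c x'"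
proof -
  obtain C :: "(('a \<Rightarrow> real) \<times> real) set" where C: "finite C" "\<forall>(f, b)\<in>C. linear f"
    and S: "S = {x. \<forall>(f, b)\<in>C. f x \<le> (b::real)}" and R: "R = {u. \<forall>(f, b)\<in>C. f u \<le> 0}"
    using poly by (rule polyhedralE)
  define T where "T x = {(f, b)\<in>C. f x = b}" for x
  define basic where "basic x \<longleftrightarrow> x \<in> S \<and> (\<forall>u. (\<forall>(f, b)\<in>T x. f u = 0) \<longrightarrow> c u = 0)" for x
  have improve: "\<exists>x'. basic x' \<and> c x' \<le> c x" if "x \<in> S" for x
    using that
  proof (induction "card (C - T x)" arbitrary: x rule: less_induct)
    case less
    show ?case
    proof (cases "basic x")
      case False
      then obtain u0 where u0: "\<forall>(f, b)\<in>T x. f u0 = 0" "c u0 \<noteq> 0"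
        using less.prems unfolding basic_def by auto
      define u where "u = (if c u0 < 0 then u0 else - u0)"
      have uT: "f u = 0" if "(f, b) \<in> T x" for f b
        using u0(1) that C(2) by (auto simp: u_def T_def linear_neg)
      have cu: "c u < 0"
        using u0(2) c by (auto simp: u_def linear_neg)
      define J where "J = {(f, b)\<in>C. 0 < f u}"
      have "J \<noteq> {}"
        using cu rec[of u] unfolding J_def R by fastforce
      have finJ: "finite J"
        using C(1) unfolding J_def by (rule rev_finite_subset) auto
      \<comment> \<open>The longest step that stays feasible; it makes a constraint of \<open>J\<close> tight.\<close>
      define t where "t = Min ((\<lambda>(f, b). (b - f x) / f u) ` J)"
      have "t \<in> (\<lambda>(f, b). (b - f x) / f u) ` J"
        unfolding t_def using finJ \<open>J \<noteq> {}\<close> by (intro Min_in) auto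
      then obtain f0 b0 where f0: "(f0, b0) \<in> J" "t = (b0 - f0 x) / f0 u"
        by auto
      have tle: "t \<le> (b - f x) / f u" if "(f, b) \<in> J" for f b
        unfolding t_def using finJ that by (intro Min_le) force+
      have t0: "0 \<le> t"
        using f0 less.prems unfolding S J_def by (auto intro!: divide_nonneg_pos)
      define x' where "x' = x + t *\<^sub>R u"
      have fx': "f x' = f x + t * f u" if "(f, b) \<in> C" for f b
        using C(2) that by (auto simp add: x'_def linear_add linear_scale)
      have "x' \<in> S"
      proof -
        have "f x' \<le> b" if fb: "(f, b) \<in> C" for f b
        proof (cases "0 < f u")
          case True
          then show ?thesis
            using tle[of f b] fb fx'[OF fb] by (simp add: J_def pos_le_divide_eq)
        next
          case False
          then have "t * f u \<le> 0" using t0 by (simp add: mult_nonneg_nonpos)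
          then show ?thesis
            using fx'[OF fb] less.prems fb unfolding S by fastforce
        qed
        then show ?thesis unfolding S by auto
      qed
      moreover have "T x \<subseteq> T x'"
        using uT fx' unfolding T_def by fastforce
      moreover have "(f0, b0) \<in> T x' - T x"
        using f0 uT[of f0 b0] fx'[of f0 b0] by (auto simp: T_def J_def)
      moreover have "(f0, b0) \<in> C" using f0 by (auto simp: J_def)
      ultimately have "card (C - T x') < card (C - T x)"
        using C(1) by (intro psubset_card_mono) auto
      from less.hyps[OF this \<open>x' \<in> S\<close>] obtain z where "basic z" "c z \<le> c x'" by auto
      moreover have "c x' \<le> c x"
        using cu t0 c by (simp add: x'_def linear_add linear_scale mult_nonneg_nonpos)
      ultimately show ?thesis by force
    qed auto
  qed
  have same: "c x = c x'" if "basic x" "basic x'" "T x = T x'" for x x'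
  proof -
    have "f (x' - x) = 0" if fb: "(f, b) \<in> T x" for f b
    proof -
      have "(f, b) \<in> T x'" using fb \<open>T x = T x'\<close> by simp
      with fb C(2) show ?thesis by (auto simp: T_def linear_diff)
    qed
    then have "c (x' - x) = 0"
      using that(1) unfolding basic_def by blast
    then show ?thesis using c by (simp add: linear_diff)
  qed
  have "c ` Collect basic \<subseteq> (\<lambda>I. c (SOME x. basic x \<and> T x = I)) ` Pow C"
  proof
    fix w assume "w \<in> c ` Collect basic"
    then obtain x where x: "basic x" "w = c x" by auto
    have "basic (SOME z. basic z \<and> T z = T x) \<and> T (SOME z. basic z \<and> T z = T x) = T x"
      by (rule someI[of _ x]) (simp add: x)
    then have "w = c (SOME z. basic z \<and> T z = T x)"
      using same x by metis
    moreover have "T x \<in> Pow C" by (auto simp: T_def)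
    ultimately show "w \<in> (\<lambda>I. c (SOME x. basic x \<and> T x = I)) ` Pow C" by blast
  qed
  then have fin: "finite (c ` Collect basic)"
    by (rule finite_subset) (simp add: C(1))
  have "c ` Collect basic \<noteq> {}"
    using improve ne by auto
  then have "Min (c ` Collect basic) \<in> c ` Collect basic"
    using fin by (intro Min_in)
  then obtain x where x: "basic x" "c x = Min (c ` Collect basic)" by auto
  have "c x \<le> c x'" if x': "x' \<in> S" for x'
  proof -
    obtain z where "basic z" "c z \<le> c x'" using improve[OF x'] by blast
    moreover have "c x \<le> c z" using x(2) fin \<open>basic z\<close> by simp
    ultimately show ?thesis by simp
  qed
  with x(1) show ?thesis unfolding basic_def by blast
qed

lemma slope_nonneg:
  fixes k :: real
  assumes "\<And>t. 0 \<le> t \<Longrightarrow> m \<le> a + t * k"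
  shows "0 \<le> k"
proof (rule ccontr)
  assume k: "\<not> 0 \<le> k"
  define t where "t = (\<bar>a - m\<bar> + 1) / (- k)"
  have "0 \<le> t" "t * k = - (\<bar>a - m\<bar> + 1)"
    using k by (simp_all add: t_def field_simps)
  with assms[of t] show False by linarith
qed

lemma polyhedral_eq:
  fixes f :: "'a::real_vector \<Rightarrow> real"
  assumes "linear f"
  shows "polyhedral {x. f x = b} {u. f u = 0}"
proof -
  have "{x. f x = b} = {x. f x \<le> b} \<inter> {x. 0 \<le> f x + - b}" "{u. f u = 0} = {u. f u \<le> 0} \<inter> {u. 0 \<le> f u}"
    by auto
  then show ?thesis
    using polyhedral_Int[OF polyhedral_const_le[OF assms, of b] polyhedral_le[OF linear_zero assms, of "- b"]]
    by simp
qed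

text \<open>Along a recession direction of descent the objective would be unbounded below.\<close>

lemma bounded_linear_program_attains:
  fixes c :: "'a::real_vector \<Rightarrow> real"
  assumes poly: "polyhedral S R" and ne: "S \<noteq> {}" and c: "linear c" and bdd: "bdd_below (c ` S)"
  shows "\<exists>x\<in>S. \<forall>x'\<in>S. c x \<le> c x'"
proof (rule linear_program_attains[OF poly ne c])
  fix u assume u: "u \<in> R"
  obtain x where x: "x \<in> S" using ne by auto
  obtain m where m: "\<And>z. z \<in> S \<Longrightarrow> m \<le> c z" using bdd unfolding bdd_below_def by auto
  have "m \<le> c x + t * c u" if "0 \<le> t" for t
    using m[OF polyhedral_recession[OF poly x u that]] c by (simp add: linear_add linear_scale)
  then show "0 \<le> c u" by (rule slope_nonneg)
qed

section \<open>The recourse function and the candidate scenarios\<close>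

locale dro_instance =
  fixes D :: "('n::finite, 'm::finite, 'y::finite, 'p::finite, 'q::finite, 's::finite) dro"
  assumes salg: "sigma_algebra (Xi D) (salg D)"
    and borel: "sets (restrict_space borel (Xi D)) \<subseteq> salg D"
    and samples: "\<And>s. smp D s \<in> Xi D"
    and prb_nonneg: "\<And>s. 0 \<le> prb D s"
    and prb_sum: "(\<Sum>s\<in>UNIV. prb D s) = 1"
    and radius: "0 \<le> radius D"
    and recourse: "relatively_complete_recourse D"
    and feasible: "first_stage D \<noteq> {}"
    and bounded: "bdd_below (total_cost D ` first_stage D)"
begin

lemma Xi_cbox: "Xi D = cbox (lo D) (hi D)"
  by (auto simp: Xi_def mem_box_cart less_eq_vec_def)

lemma in_Xi_iff: "\<xi> \<in> Xi D \<longleftrightarrow> (\<forall>i. lo D $ i \<le> \<xi> $ i \<and> \<xi> $ i \<le> hi D $ i)"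
  by (auto simp: Xi_def less_eq_vec_def)

lemma candidates_subset_Xi: "candidates D s \<subseteq> Xi D"
proof
  fix \<xi> assume "\<xi> \<in> candidates D s"
  then have c: "\<xi> $ i \<in> {hi D $ i, lo D $ i, smp D s $ i}" for i
    by (auto simp: candidates_def)
  have "lo D $ i \<le> smp D s $ i \<and> smp D s $ i \<le> hi D $ i" for i
    using samples[of s] in_Xi_iff by blast
  then have "lo D $ i \<le> \<xi> $ i \<and> \<xi> $ i \<le> hi D $ i" for i
    using c[of i] by (smt (verit) insert_iff singletonD)
  then show "\<xi> \<in> Xi D"
    unfolding in_Xi_iff by blast
qed

lemma sample_in_candidates: "smp D s \<in> candidates D s"
  by (simp add: candidates_def)

lemma candidates_finite_card:
  shows finite_candidates: "finite (candidates D s)"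
    and card_candidates: "card (candidates D s) \<le> 3 ^ CARD('m)"
proof -
  let ?V = "\<lambda>i. {hi D $ i, lo D $ i, smp D s $ i}"
  let ?A = "PiE UNIV ?V"
  have sub: "candidates D s \<subseteq> (\<lambda>f. \<chi> i. f i) ` ?A"
  proof
    fix \<xi> assume "\<xi> \<in> candidates D s"
    then have "($) \<xi> \<in> ?A" by (simp add: candidates_def PiE_def Pi_def)
    moreover have "\<xi> = (\<chi> i. \<xi> $ i)" by simp
    ultimately show "\<xi> \<in> (\<lambda>f. \<chi> i. f i) ` ?A" by blast
  qed
  have fin: "finite ?A" by (intro finite_PiE) auto
  show "finite (candidates D s)"
    using sub fin finite_surj by blast
  have "card (candidates D s) \<le> card ?A"
    using sub fin surj_card_le by blast
  also have "\<dots> = (\<Prod>i\<in>UNIV. card (?V i))" by (simp add: card_PiE)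
  also have "\<dots> \<le> (\<Prod>i\<in>(UNIV::'m set). 3)"
    by (intro prod_mono) (auto simp: card_insert_if)
  finally show "card (candidates D s) \<le> 3 ^ CARD('m)" by simp
qed

text \<open>The offset \<open>x0\<close> serves two uses: with \<open>X = 0\<close> the first-stage decision is the fixed vector
  \<open>x0\<close>, and with \<open>x0 = 0\<close> it is a variable of the linear program.\<close>

lemma polyhedral_recourse:
  fixes X :: "'a::real_vector \<Rightarrow> real ^ 'n" and Y :: "'a \<Rightarrow> real ^ 'y"
  assumes "linear X" "linear Y"
  shows "polyhedral {z. Y z \<in> recourse D (x0 + X z) \<xi>}
    {u. 0 \<le> Y u \<and> Fmat D *v Y u \<le> - (Gmat D *v X u)}"
proof -
  have 1: "polyhedral {z. (0 :: real ^ 'y) \<le> Y z + 0} {u. (0 :: real ^ 'y) \<le> Y u}"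
    by (rule polyhedral_vec_le[OF linear_zero assms(2)])
  have "linear (\<lambda>z. Fmat D *v Y z)"
    using linear_compose[OF assms(2) matrix_vector_mul_linear] by (simp add: o_def)
  moreover have "linear (\<lambda>z. - (Gmat D *v X z))"
    using linear_compose_neg[OF linear_compose[OF assms(1) matrix_vector_mul_linear]] by (simp add: o_def)
  ultimately have 2: "polyhedral
      {z. Fmat D *v Y z \<le> - (Gmat D *v X z) + (hvec D - Gmat D *v x0 - Kmat D *v \<xi>)}
      {u. Fmat D *v Y u \<le> - (Gmat D *v X u)}"
    by (rule polyhedral_vec_le)
  have "{z. Y z \<in> recourse D (x0 + X z) \<xi>} = {z. (0 :: real ^ 'y) \<le> Y z + 0} \<inter>
      {z. Fmat D *v Y z \<le> - (Gmat D *v X z) + (hvec D - Gmat D *v x0 - Kmat D *v \<xi>)}"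
  proof -
    have "hvec D - Gmat D *v (x0 + X z) - Kmat D *v \<xi> =
        - (Gmat D *v X z) + (hvec D - Gmat D *v x0 - Kmat D *v \<xi>)" for z
      by (simp add: matrix_vector_right_distrib)
    then show ?thesis
      unfolding recourse_def by (simp only: add_0_right Collect_conj_eq mem_Collect_eq Int_iff)
  qed
  moreover have "{u. 0 \<le> Y u \<and> Fmat D *v Y u \<le> - (Gmat D *v X u)} =
      {u. (0 :: real ^ 'y) \<le> Y u} \<inter> {u. Fmat D *v Y u \<le> - (Gmat D *v X u)}"
    by auto
  ultimately show ?thesis
    using polyhedral_Int[OF 1 2] by simp
qed

lemma Q_le:
  assumes "x \<in> first_stage D" "\<xi> \<in> Xi D" "y \<in> recourse D x \<xi>"
  shows "Q D x \<xi> \<le> dvec D \<bullet> y"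
  unfolding Q_def using assms recourse
  by (intro cINF_lower) (auto simp: relatively_complete_recourse_def)

lemma Q_attained:
  assumes "x \<in> first_stage D" "\<xi> \<in> Xi D"
  shows "\<exists>y\<in>recourse D x \<xi>. Q D x \<xi> = dvec D \<bullet> y"
proof -
  have "polyhedral (recourse D x \<xi>) {u. 0 \<le> u \<and> Fmat D *v u \<le> 0}"
    using polyhedral_recourse[OF linear_zero linear_id, of x \<xi>] by simp
  moreover have "linear (\<lambda>y. dvec D \<bullet> y)"
    by (intro linearI) (simp_all add: inner_add_right)
  moreover have "recourse D x \<xi> \<noteq> {}" "bdd_below ((\<lambda>y. dvec D \<bullet> y) ` recourse D x \<xi>)"
    using recourse assms by (simp_all add: relatively_complete_recourse_def)
  ultimately have "\<exists>y\<in>recourse D x \<xi>. \<forall>y'\<in>recourse D x \<xi>. dvec D \<bullet> y \<le> dvec D \<bullet> y'"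
    by (intro bounded_linear_program_attains)
  then obtain y where y: "y \<in> recourse D x \<xi>"
      "\<forall>y'\<in>recourse D x \<xi>. dvec D \<bullet> y \<le> dvec D \<bullet> y'"
    by blast
  have "Q D x \<xi> = dvec D \<bullet> y"
    unfolding Q_def by (rule cInf_eq_minimum) (use y in auto)
  with y(1) show ?thesis by blast
qed

lemma recourse_convex_combination:
  assumes "y \<in> recourse D x \<xi>" "y' \<in> recourse D x \<xi>'" "0 \<le> t" "t \<le> 1"
  shows "(1 - t) *\<^sub>R y + t *\<^sub>R y' \<in> recourse D x ((1 - t) *\<^sub>R \<xi> + t *\<^sub>R \<xi>')"
proof -
  have "0 \<le> (1 - t) *\<^sub>R y + t *\<^sub>R y'"
    using assms by (auto simp: recourse_def less_eq_vec_def)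
  moreover have "Fmat D *v ((1 - t) *\<^sub>R y + t *\<^sub>R y') =
      (1 - t) *\<^sub>R (Fmat D *v y) + t *\<^sub>R (Fmat D *v y')"
    by (simp add: matrix_vector_right_distrib matrix_vector_mult_scaleR)
  moreover have "\<dots> \<le> (1 - t) *\<^sub>R (hvec D - Gmat D *v x - Kmat D *v \<xi>)
      + t *\<^sub>R (hvec D - Gmat D *v x - Kmat D *v \<xi>')"
    using assms by (intro add_mono scaleR_left_mono) (auto simp: recourse_def)
  moreover have "\<dots> = hvec D - Gmat D *v x - Kmat D *v ((1 - t) *\<^sub>R \<xi> + t *\<^sub>R \<xi>')"
  proof -
    have K: "Kmat D *v ((1 - t) *\<^sub>R \<xi> + t *\<^sub>R \<xi>') =
        (1 - t) *\<^sub>R (Kmat D *v \<xi>) + t *\<^sub>R (Kmat D *v \<xi>')"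
      by (simp add: matrix_vector_right_distrib matrix_vector_mult_scaleR)
    show ?thesis unfolding K
      by (simp add: scaleR_diff_right scaleR_diff_left)
  qed
  ultimately show ?thesis
    by (simp add: recourse_def)
qed

text \<open>Convex combinations of optimal recourse decisions are feasible for the combined scenario.\<close>

lemma Q_convex:
  assumes x: "x \<in> first_stage D" and \<xi>: "\<xi> \<in> Xi D" "\<xi>' \<in> Xi D" and t: "0 \<le> t" "t \<le> 1"
  shows "Q D x ((1 - t) *\<^sub>R \<xi> + t *\<^sub>R \<xi>') \<le> (1 - t) * Q D x \<xi> + t * Q D x \<xi>'"
proof -
  obtain y y' where y: "y \<in> recourse D x \<xi>" "Q D x \<xi> = dvec D \<bullet> y"
      "y' \<in> recourse D x \<xi>'" "Q D x \<xi>' = dvec D \<bullet> y'"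
    using Q_attained x \<xi> by meson
  have "(1 - t) *\<^sub>R \<xi> + t *\<^sub>R \<xi>' \<in> Xi D"
    using \<xi> t unfolding Xi_cbox by (intro convexD_alt convex_box) auto
  then have "Q D x ((1 - t) *\<^sub>R \<xi> + t *\<^sub>R \<xi>') \<le> dvec D \<bullet> ((1 - t) *\<^sub>R y + t *\<^sub>R y')"
    using y t by (intro Q_le[OF x] recourse_convex_combination) auto
  then show ?thesis
    using y by (simp add: inner_add_right)
qed

definition coord_upd :: "real ^ 'm \<Rightarrow> 'm \<Rightarrow> real \<Rightarrow> real ^ 'm" where
  "coord_upd z i t = (\<chi> j. if j = i then t else z $ j)"

lemma coord_upd_nth [simp]: "coord_upd z i t $ j = (if j = i then t else z $ j)"
  by (simp add: coord_upd_def)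

text \<open>Moving only coordinate \<open>i\<close> between \<open>p\<close> and \<open>q\<close>, one stays on one side of \<open>e $ i\<close>. The norm is affine
  on this segment, so the penalised recourse cost is convex there and is largest at one of the two
  ends.\<close>

lemma penalised_recourse_endpoint:
  fixes \<beta> :: real
  assumes x: "x \<in> first_stage D" and z: "z \<in> Xi D"
    and pq: "lo D $ i \<le> p" "p \<le> z $ i" "z $ i \<le> q" "q \<le> hi D $ i"
    and side: "q \<le> e $ i \<or> e $ i \<le> p"
  defines "f \<equiv> \<lambda>\<xi>. Q D x \<xi> - \<beta> * l1 (\<xi> - e)"
  shows "\<exists>t\<in>{p, q}. f z \<le> f (coord_upd z i t)"
proof (cases "p = q")
  case True
  then have "coord_upd z i p = z"
    using pq by (simp add: vec_eq_iff)
  then show ?thesis by auto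
next
  case False
  then have "p < q" using pq by simp
  define w where "w = (z $ i - p) / (q - p)"
  have l: "0 \<le> w" "w \<le> 1" "z $ i = (1 - w) * p + w * q"
    using \<open>p < q\<close> pq by (simp_all add: w_def divide_simps) (simp add: algebra_simps)
  let ?p = "coord_upd z i p" and ?q = "coord_upd z i q"
  have zc: "z = (1 - w) *\<^sub>R ?p + w *\<^sub>R ?q"
    using l(3) by (simp add: vec_eq_iff algebra_simps)
  have "?p \<in> Xi D" "?q \<in> Xi D"
    using z pq by (auto simp: in_Xi_iff)
  then have Qz: "Q D x z \<le> (1 - w) * Q D x ?p + w * Q D x ?q"
    by (subst zc) (intro Q_convex x l)
  have abs_affine: "\<bar>z $ j - e $ j\<bar> = (1 - w) * \<bar>?p $ j - e $ j\<bar> + w * \<bar>?q $ j - e $ j\<bar>" for j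
  proof (cases "j = i")
    case True
    have zi: "z $ i - e $ i = (1 - w) * (p - e $ i) + w * (q - e $ i)"
      using l(3) by (simp add: algebra_simps)
    from side show ?thesis
    proof
      assume "q \<le> e $ i"
      then have "\<bar>z $ i - e $ i\<bar> = - (z $ i - e $ i)" "\<bar>p - e $ i\<bar> = - (p - e $ i)" "\<bar>q - e $ i\<bar> = - (q - e $ i)"
        using pq by auto
      then show ?thesis using True zi by (simp add: algebra_simps)
    next
      assume "e $ i \<le> p"
      then have "\<bar>z $ i - e $ i\<bar> = z $ i - e $ i" "\<bar>p - e $ i\<bar> = p - e $ i" "\<bar>q - e $ i\<bar> = q - e $ i"
        using pq by auto
      then show ?thesis using True zi by simp
    qed
  qed (simp add: algebra_simps)
  have "l1 (z - e) = (1 - w) * l1 (?p - e) + w * l1 (?q - e)"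
    unfolding l1_def vector_minus_component
    by (subst abs_affine) (simp only: sum.distrib sum_distrib_left)
  note l1_affine = this
  have "(1 - w) * f ?p + w * f ?q =
      ((1 - w) * Q D x ?p + w * Q D x ?q) - \<beta> * l1 (z - e)"
    unfolding f_def l1_affine by (simp add: algebra_simps)
  with Qz have "f z \<le> (1 - w) * f ?p + w * f ?q"
    unfolding f_def by linarith
  moreover have "(1 - w) * f ?p + w * f ?q \<le> (1 - w) * max (f ?p) (f ?q) + w * max (f ?p) (f ?q)"
    using l by (intro add_mono mult_left_mono) auto
  ultimately have "f z \<le> max (f ?p) (f ?q)"
    by (simp add: algebra_simps)
  then show ?thesis by (auto simp: max_def split: if_splits)
qed

text \<open>Push the coordinates one after the other to an end of the box or to the sample. Each
  coordinate is moved within the part of its interval on its own side of the sample coordinate.\<close>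

lemma candidate_dominates:
  assumes x: "x \<in> first_stage D" and \<xi>: "\<xi> \<in> Xi D"
  shows "\<exists>z\<in>candidates D s. Q D x \<xi> - \<beta> * l1 (\<xi> - smp D s) \<le> Q D x z - \<beta> * l1 (z - smp D s)"
proof -
  define f where "f = (\<lambda>\<xi>. Q D x \<xi> - \<beta> * l1 (\<xi> - smp D s))"
  have "\<exists>z\<in>Xi D. (\<forall>i\<in>I. z $ i \<in> {hi D $ i, lo D $ i, smp D s $ i}) \<and> f \<xi> \<le> f z" if "finite I" for I
    using that
  proof (induction I rule: finite_induct)
    case empty
    show ?case using \<xi> by auto
  next
    case (insert i I)
    then obtain z where z: "z \<in> Xi D" "\<forall>i\<in>I. z $ i \<in> {hi D $ i, lo D $ i, smp D s $ i}" "f \<xi> \<le> f z"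
      by auto
    have e: "lo D $ i \<le> smp D s $ i" "smp D s $ i \<le> hi D $ i"
      and zi: "lo D $ i \<le> z $ i" "z $ i \<le> hi D $ i"
      using samples[of s] z(1) unfolding in_Xi_iff by auto
    have "\<exists>t\<in>{hi D $ i, lo D $ i, smp D s $ i}. f z \<le> f (coord_upd z i t)"
    proof (cases "z $ i \<le> smp D s $ i")
      case True
      have "\<exists>t\<in>{lo D $ i, smp D s $ i}. f z \<le> f (coord_upd z i t)"
        unfolding f_def by (rule penalised_recourse_endpoint[OF x z(1)]) (use e zi True in auto)
      then show ?thesis by blast
    next
      case False
      have "\<exists>t\<in>{smp D s $ i, hi D $ i}. f z \<le> f (coord_upd z i t)"
        unfolding f_def by (rule penalised_recourse_endpoint[OF x z(1)]) (use e zi False in auto)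
      then show ?thesis by blast
    qed
    then obtain t where t: "t \<in> {hi D $ i, lo D $ i, smp D s $ i}" "f z \<le> f (coord_upd z i t)"
      by blast
    have "coord_upd z i t \<in> Xi D"
      using z(1) t(1) e by (auto simp: in_Xi_iff)
    moreover have "\<forall>j\<in>insert i I. coord_upd z i t $ j \<in> {hi D $ j, lo D $ j, smp D s $ j}"
      using z(2) t(1) by auto
    ultimately show ?case
      using z(3) t(2) by (intro bexI[of _ "coord_upd z i t"]) auto
  qed
  from this[of UNIV] show ?thesis
    unfolding f_def candidates_def by auto
qed

text \<open>A convex function on a box that is bounded above is bounded below as well: its value at the
  centre is at most the mean of its values at a point and at the reflected point.\<close>

lemma Q_bounded:
  assumes x: "x \<in> first_stage D"
  shows "\<exists>B\<ge>0. \<forall>\<xi>\<in>Xi D. \<bar>Q D x \<xi>\<bar> \<le> B"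
proof -
  fix s :: 's
  define U where "U = Max (Q D x ` candidates D s)"
  have U: "Q D x \<xi> \<le> U" if \<xi>: "\<xi> \<in> Xi D" for \<xi>
  proof -
    \<comment> \<open>With penalty rate \<open>0\<close>, domination by candidates bounds \<open>Q\<close> itself.\<close>
    obtain z where "z \<in> candidates D s" "Q D x \<xi> \<le> Q D x z"
      using candidate_dominates[OF x \<xi>, of s 0] by auto
    then show ?thesis
      unfolding U_def using finite_candidates[of s] by (meson Max_ge finite_imageI image_eqI order_trans)
  qed
  define mid where "mid = (1 - 1/2) *\<^sub>R lo D + (1/2) *\<^sub>R hi D"
  have L: "2 * Q D x mid - U \<le> Q D x \<xi>" if \<xi>: "\<xi> \<in> Xi D" for \<xi>
  proof -
    define \<xi>' where "\<xi>' = lo D + hi D - \<xi>"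
    have \<xi>': "\<xi>' \<in> Xi D" using \<xi> by (simp add: in_Xi_iff \<xi>'_def)
    have "mid = (1 - 1/2) *\<^sub>R \<xi> + (1/2) *\<^sub>R \<xi>'"
      by (simp add: mid_def \<xi>'_def vec_eq_iff algebra_simps)
    then have "Q D x mid \<le> (1 - 1/2) * Q D x \<xi> + 1/2 * Q D x \<xi>'"
      using Q_convex[OF x \<xi> \<xi>', of "1/2"] by simp
    with U[OF \<xi>'] show ?thesis by simp
  qed
  have "\<bar>Q D x \<xi>\<bar> \<le> \<bar>U\<bar> + \<bar>2 * Q D x mid - U\<bar>" if "\<xi> \<in> Xi D" for \<xi>
    using U[OF that] L[OF that] by linarith
  then show ?thesis by (intro exI[of _ "\<bar>U\<bar> + \<bar>2 * Q D x mid - U\<bar>"]) auto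
qed

text \<open>A strict sublevel set is a countable union of projections of compact sets of pairs of a
  scenario and a recourse decision, and hence a Borel set.\<close>

lemma Q_measurable:
  assumes x: "x \<in> first_stage D"
    and M: "space M = Xi D" "sets (restrict_space borel (Xi D)) \<subseteq> sets M"
  shows "Q D x \<in> borel_measurable M"
proof -
  have "{\<xi> \<in> Xi D. Q D x \<xi> < a} \<in> sets borel" for a
  proof -
    define C where "C n = {(\<xi>, y). \<xi> \<in> Xi D \<and> y \<in> recourse D x \<xi> \<and> norm y \<le> real n \<and>
      dvec D \<bullet> y \<le> a - 1 / real (Suc n)}" for n
    have cl: "closed (C n)" for n
    proof -
      have "C n = {z. \<forall>i. lo D $ i \<le> fst z $ i} \<inter> {z. \<forall>i. fst z $ i \<le> hi D $ i} \<inter>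
          {z. \<forall>j. 0 \<le> snd z $ j} \<inter>
          {z. \<forall>k. (Fmat D *v snd z) $ k \<le> (hvec D - Gmat D *v x - Kmat D *v fst z) $ k} \<inter>
          {z. norm (snd z) \<le> real n} \<inter> {z. dvec D \<bullet> snd z \<le> a - 1 / real (Suc n)}"
        by (auto simp: C_def in_Xi_iff recourse_def less_eq_vec_def)
      then show ?thesis
        by (auto intro!: closed_Int closed_Collect_all closed_Collect_le continuous_intros
            matrix_vector_mult_linear_continuous_on[THEN continuous_on_compose2])
    qed
    have "C n \<subseteq> cbox (lo D) (hi D) \<times> cball 0 (real n)" for n
      by (auto simp: C_def Xi_cbox)
    then have "compact (C n)" for n
      using cl compact_Int_closed[of "cbox (lo D) (hi D) \<times> cball 0 (real n)" "C n"]
      by (simp add: compact_Times Int_absorb1)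
    then have "closed (fst ` C n)" for n
      by (intro compact_imp_closed compact_continuous_image continuous_intros)
    moreover have "{\<xi> \<in> Xi D. Q D x \<xi> < a} = (\<Union>n. fst ` C n)"
    proof (intro set_eqI iffI)
      fix \<xi> assume \<xi>: "\<xi> \<in> {\<xi> \<in> Xi D. Q D x \<xi> < a}"
      obtain y where y: "y \<in> recourse D x \<xi>" "Q D x \<xi> = dvec D \<bullet> y"
        using Q_attained x \<xi> by blast
      obtain n1 where n1: "norm y \<le> real n1" using real_arch_simple by blast
      obtain n2 where n2: "1 / real (Suc n2) < a - Q D x \<xi>"
        using \<xi> nat_approx_posE[of "a - Q D x \<xi>"] by auto
      define n where "n = max n1 n2"
      have "1 / real (Suc n) \<le> 1 / real (Suc n2)" by (simp add: n_def divide_simps)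
      then have "(\<xi>, y) \<in> C n"
        using \<xi> y n1 n2 by (auto simp: C_def n_def)
      then show "\<xi> \<in> (\<Union>n. fst ` C n)" by force
    next
      fix \<xi> assume "\<xi> \<in> (\<Union>n. fst ` C n)"
      then obtain n y where ny: "\<xi> \<in> Xi D" "y \<in> recourse D x \<xi>" "dvec D \<bullet> y \<le> a - 1 / real (Suc n)"
        by (auto simp: C_def)
      have "0 < 1 / real (Suc n)" by simp
      then have "Q D x \<xi> < a"
        using Q_le[OF x ny(1,2)] ny(3) by linarith
      with ny(1) show "\<xi> \<in> {\<xi> \<in> Xi D. Q D x \<xi> < a}" by simp
    qed
    ultimately show ?thesis by auto
  qed
  then have "{\<xi> \<in> Xi D. Q D x \<xi> < a} \<in> sets (restrict_space borel (Xi D))" for a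
    by (subst sets_restrict_space_iff) (auto simp: Xi_cbox)
  then show ?thesis
    using M by (auto simp: borel_measurable_iff_less)
qed

section \<open>Duality for the pricing master problem\<close>

definition primal_value :: "real ^ 'n \<Rightarrow> ('s \<Rightarrow> (real ^ 'm) set) \<Rightarrow> ('s \<Rightarrow> real ^ 'm \<Rightarrow> real) \<Rightarrow> real" where
  "primal_value x \<Omega> p = (\<Sum>s\<in>UNIV. \<Sum>\<xi>\<in>\<Omega> s. prb D s * Q D x \<xi> * p s \<xi>)"

definition dual_value :: "('s \<Rightarrow> real) \<Rightarrow> real \<Rightarrow> real" where
  "dual_value \<alpha> \<beta> = (\<Sum>s\<in>UNIV. \<alpha> s) + radius D * \<beta>"

lemma pricing_master_feasible_finite:
  assumes "pricing_master_feasible D \<Omega> p"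
  shows "finite (\<Omega> s)" "\<Omega> s \<noteq> {}"
proof -
  have "(\<Sum>\<xi>\<in>\<Omega> s. p s \<xi>) = 1"
    using assms by (simp add: pricing_master_feasible_def)
  then show "finite (\<Omega> s)" "\<Omega> s \<noteq> {}"
    using sum.infinite by fastforce+
qed

lemma pricing_master_feasible_mono:
  assumes p: "pricing_master_feasible D \<Omega> p" and sub: "\<And>s. \<Omega> s \<subseteq> \<Omega>' s" and fin: "\<And>s. finite (\<Omega>' s)"
  shows "pricing_master_feasible D \<Omega>' (\<lambda>s \<xi>. if \<xi> \<in> \<Omega> s then p s \<xi> else 0)"
proof -
  have "(\<Sum>\<xi>\<in>\<Omega>' s. g \<xi> * (if \<xi> \<in> \<Omega> s then p s \<xi> else 0)) = (\<Sum>\<xi>\<in>\<Omega> s. g \<xi> * p s \<xi>)" for g s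
    using sub[of s] fin[of s] by (intro sum.mono_neutral_cong_right) auto
  from this[of "\<lambda>_. 1"] this show ?thesis
    using p by (simp add: pricing_master_feasible_def)
qed

text \<open>Weak duality with arbitrary values \<open>q\<close> in the place of the recourse function. It is used for
  the recourse function, and for the change of recourse cost along a direction of the main master problem.\<close>

lemma weighted_values_le_dual_value:
  assumes p: "pricing_master_feasible D \<Omega> p" and \<beta>: "0 \<le> \<beta>"
    and le: "\<And>s \<xi>. \<xi> \<in> \<Omega> s \<Longrightarrow> prb D s * q s \<xi> \<le> \<alpha> s + prb D s * l1 (\<xi> - smp D s) * \<beta>"
  shows "(\<Sum>s\<in>UNIV. \<Sum>\<xi>\<in>\<Omega> s. prb D s * q s \<xi> * p s \<xi>) \<le> dual_value \<alpha> \<beta>"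
proof -
  have "(\<Sum>s\<in>UNIV. \<Sum>\<xi>\<in>\<Omega> s. prb D s * q s \<xi> * p s \<xi>) \<le>
      (\<Sum>s\<in>UNIV. \<Sum>\<xi>\<in>\<Omega> s. (\<alpha> s + prb D s * l1 (\<xi> - smp D s) * \<beta>) * p s \<xi>)"
    using p le by (intro sum_mono mult_right_mono) (auto simp: pricing_master_feasible_def)
  also have "\<dots> = (\<Sum>s\<in>UNIV. \<alpha> s * (\<Sum>\<xi>\<in>\<Omega> s. p s \<xi>) +
      \<beta> * (prb D s * (\<Sum>\<xi>\<in>\<Omega> s. l1 (\<xi> - smp D s) * p s \<xi>)))"
    by (intro sum.cong) (simp_all add: sum.distrib sum_distrib_left algebra_simps)
  also have "\<dots> = (\<Sum>s\<in>UNIV. \<alpha> s) +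
      \<beta> * (\<Sum>s\<in>UNIV. prb D s * (\<Sum>\<xi>\<in>\<Omega> s. l1 (\<xi> - smp D s) * p s \<xi>))"
    using p by (simp add: pricing_master_feasible_def sum.distrib sum_distrib_left)
  also have "\<dots> \<le> (\<Sum>s\<in>UNIV. \<alpha> s) + \<beta> * radius D"
    using p \<beta> by (intro add_left_mono mult_left_mono) (auto simp: pricing_master_feasible_def)
  finally show ?thesis by (simp add: dual_value_def mult.commute)
qed

lemma weak_duality:
  assumes "pricing_master_feasible D \<Omega> p" "multipliers_feasible D x \<Omega> \<alpha> \<beta>"
  shows "primal_value x \<Omega> p \<le> dual_value \<alpha> \<beta>"
  unfolding primal_value_def using assms
  by (intro weighted_values_le_dual_value) (auto simp: multipliers_feasible_def)

lemma linear_sum_components: "linear (\<lambda>z :: ('s \<Rightarrow> real) \<times> 'b::real_vector. \<Sum>s\<in>UNIV. fst z s)"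
  by (intro linearI) (simp_all add: sum.distrib sum_distrib_left)

text \<open>The multipliers range over a polyhedron, and weak duality bounds their objective from below.\<close>

lemma optimal_multipliers_exist:
  assumes p: "pricing_master_feasible D \<Omega> p"
  shows "\<exists>\<alpha> \<beta>. multipliers_optimal D x \<Omega> \<alpha> \<beta>"
proof -
  define S where "S = {z. multipliers_feasible D x \<Omega> (fst z) (snd z)}"
  define R where "R = {z :: ('s \<Rightarrow> real) \<times> real. 0 \<le> snd z} \<inter>
    (\<Inter>s\<in>UNIV. \<Inter>\<xi>\<in>\<Omega> s. {z. 0 \<le> fst z s + prb D s * l1 (\<xi> - smp D s) * snd z})"
  define c where "c = (\<lambda>z :: ('s \<Rightarrow> real) \<times> real. dual_value (fst z) (snd z))"
  note fin = pricing_master_feasible_finite[OF p]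
  have lin: "linear (\<lambda>z :: ('s \<Rightarrow> real) \<times> real. snd z)"
    "linear (\<lambda>z :: ('s \<Rightarrow> real) \<times> real. fst z s + k * snd z)" for s k
    by (intro linearI; simp add: algebra_simps)+
  have "S = {z. 0 \<le> snd z + 0} \<inter>
      (\<Inter>s\<in>UNIV. \<Inter>\<xi>\<in>\<Omega> s. {z. 0 \<le> fst z s + prb D s * l1 (\<xi> - smp D s) * snd z + - (prb D s * Q D x \<xi>)})"
    by (auto simp: S_def multipliers_feasible_def)
  moreover have "polyhedral \<dots> R"
    unfolding R_def using fin
    by (intro polyhedral_Int polyhedral_INT polyhedral_le[OF linear_zero lin(1)] polyhedral_le[OF linear_zero lin(2)]) auto
  ultimately have poly: "polyhedral S R" by simp
  moreover have "S \<noteq> {}"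
  proof -
    define \<alpha> where "\<alpha> s = Max ((\<lambda>\<xi>. prb D s * Q D x \<xi>) ` \<Omega> s)" for s
    have "(\<alpha>, 0) \<in> S"
      using fin by (auto simp: S_def multipliers_feasible_def \<alpha>_def intro!: Max_ge)
    then show ?thesis by blast
  qed
  moreover have "linear c"
    unfolding c_def dual_value_def
    by (intro linear_compose_add linear_sum_components) (intro linearI; simp add: algebra_simps)
  moreover have "bdd_below (c ` S)"
    using weak_duality[OF p] by (auto simp: bdd_below_def c_def S_def)
  ultimately obtain z where "z \<in> S" "\<forall>z'\<in>S. c z \<le> c z'"
    using bounded_linear_program_attains by blast
  then have "multipliers_optimal D x \<Omega> (fst z) (snd z)"
    by (auto simp: multipliers_optimal_def S_def c_def dual_value_def)
  then show ?thesis by blast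
qed

text \<open>A short step in the direction \<open>(a, b)\<close> leads to feasible multipliers: the constraints that are
  not active have slack, and those that are active do not get worse.\<close>

lemma dual_improving_direction:
  assumes m: "multipliers_optimal D x \<Omega> \<alpha> \<beta>" and fin: "\<And>s. finite (\<Omega> s)"
    and active: "\<And>s \<xi>. \<xi> \<in> \<Omega> s \<Longrightarrow> prb D s * Q D x \<xi> = \<alpha> s + prb D s * l1 (\<xi> - smp D s) * \<beta> \<Longrightarrow>
      0 \<le> a s + prb D s * l1 (\<xi> - smp D s) * b"
    and sign: "\<beta> = 0 \<Longrightarrow> 0 \<le> b"
  shows "0 \<le> dual_value a b"
proof -
  have feas: "multipliers_feasible D x \<Omega> \<alpha> \<beta>" using m by (simp add: multipliers_optimal_def)
  have pos: "\<forall>\<^sub>F e in at_right 0. 0 \<le> u + e * k" if "0 < u \<or> u = 0 \<and> 0 \<le> k" for u k :: real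
    using that
  proof
    assume "0 < u"
    have "((\<lambda>e. u + e * k) \<longlongrightarrow> u + 0 * k) (at_right 0)" by (intro tendsto_intros)
    then have "\<forall>\<^sub>F e in at_right 0. 0 < u + e * k"
      using \<open>0 < u\<close> by (intro order_tendstoD(1)) auto
    then show ?thesis by (rule eventually_mono) auto
  next
    assume "u = 0 \<and> 0 \<le> k"
    then show ?thesis
      using eventually_at_right_less[of "0::real"] by (auto elim!: eventually_mono)
  qed
  have "\<forall>\<^sub>F e in at_right 0. \<forall>s\<in>UNIV. \<forall>\<xi>\<in>\<Omega> s.
      0 \<le> (\<alpha> s + prb D s * l1 (\<xi> - smp D s) * \<beta> - prb D s * Q D x \<xi>)
        + e * (a s + prb D s * l1 (\<xi> - smp D s) * b)"
    using feas active fin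
    by (intro eventually_ball_finite ballI pos) (force simp: multipliers_feasible_def)+
  moreover have "\<forall>\<^sub>F e in at_right 0. 0 \<le> \<beta> + e * b"
    using feas sign by (intro pos) (auto simp: multipliers_feasible_def)
  ultimately have "\<forall>\<^sub>F e in at_right 0. 0 < e \<and> 0 \<le> \<beta> + e * b \<and> (\<forall>s\<in>UNIV. \<forall>\<xi>\<in>\<Omega> s.
      0 \<le> (\<alpha> s + prb D s * l1 (\<xi> - smp D s) * \<beta> - prb D s * Q D x \<xi>)
        + e * (a s + prb D s * l1 (\<xi> - smp D s) * b))"
    using eventually_at_right_less[of "0::real"] by (intro eventually_conj)
  then obtain e where e: "0 < e" "0 \<le> \<beta> + e * b" "\<And>s \<xi>. \<xi> \<in> \<Omega> s \<Longrightarrow>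
      0 \<le> (\<alpha> s + prb D s * l1 (\<xi> - smp D s) * \<beta> - prb D s * Q D x \<xi>)
        + e * (a s + prb D s * l1 (\<xi> - smp D s) * b)"
    using eventually_happens'[OF trivial_limit_at_right_real] by blast
  have "multipliers_feasible D x \<Omega> (\<lambda>s. \<alpha> s + e * a s) (\<beta> + e * b)"
    using e unfolding multipliers_feasible_def by (force simp: algebra_simps)
  then have "dual_value \<alpha> \<beta> \<le> dual_value (\<lambda>s. \<alpha> s + e * a s) (\<beta> + e * b)"
    using m unfolding multipliers_optimal_def dual_value_def by blast
  also have "\<dots> = dual_value \<alpha> \<beta> + e * dual_value a b"
    by (simp add: dual_value_def sum.distrib sum_distrib_left algebra_simps)
  finally show ?thesis
    using e(1) by (simp add: zero_le_mult_iff)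
qed

text \<open>Optimal multipliers leave no room for improvement. Raising \<open>\<beta>\<close> at unit rate, while each \<open>\<alpha> s\<close> drops
  as fast as the active scenario nearest to the sample permits, shows that transport to these nearest
  scenarios costs at most the radius. Lowering \<open>\<beta>\<close>, which is possible for \<open>\<beta> > 0\<close>, shows that transport to
  the farthest active scenarios costs at least the radius. A mixture of the two plans meets the
  radius exactly if \<open>\<beta> > 0\<close>, and complementary slackness gives equal values.\<close>

lemma strong_duality:
  assumes m: "multipliers_optimal D x \<Omega> \<alpha> \<beta>" and fin: "\<And>s. finite (\<Omega> s)"
  shows "\<exists>p. pricing_master_feasible D \<Omega> p \<and> primal_value x \<Omega> p = dual_value \<alpha> \<beta>"
proof -
  have feas: "multipliers_feasible D x \<Omega> \<alpha> \<beta>" using m by (simp add: multipliers_optimal_def)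
  then have \<beta>0: "0 \<le> \<beta>" by (simp add: multipliers_feasible_def)
  define A where "A s = {\<xi>\<in>\<Omega> s. prb D s * Q D x \<xi> = \<alpha> s + prb D s * l1 (\<xi> - smp D s) * \<beta>}" for s
  define cost where "cost s \<xi> = l1 (\<xi> - smp D s)" for s \<xi>
  note improving = dual_improving_direction[OF m fin]
  have finA: "finite (A s)" for s using fin[of s] by (simp add: A_def)
  have neA: "A s \<noteq> {}" for s
  proof
    assume "A s = {}"
    \<comment> \<open>Without an active scenario, \<open>\<alpha> s\<close> alone could be lowered.\<close>
    then have "0 \<le> dual_value (\<lambda>s'. if s' = s then - 1 else 0) 0"
      by (intro improving) (auto simp: A_def)
    then show False by (simp add: dual_value_def)
  qed
  have min_A: "\<exists>z\<in>A s. \<forall>z'\<in>A s. g z \<le> g z'" for s and g :: "_ \<Rightarrow> real"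
  proof -
    have "Min (g ` A s) \<in> g ` A s"
      using finA neA by (intro Min_in) auto
    then obtain z where "z \<in> A s" "g z = Min (g ` A s)" by auto
    then show ?thesis using finA[of s] by (intro bexI[of _ z]) auto
  qed
  have "\<exists>z\<in>A s. \<forall>z'\<in>A s. cost s z \<le> cost s z'" "\<exists>z\<in>A s. \<forall>z'\<in>A s. cost s z' \<le> cost s z" for s
    using min_A[of s "cost s"] min_A[of s "\<lambda>z. - cost s z"] by auto
  then obtain near far where near: "\<And>s. near s \<in> A s" "\<And>s z. z \<in> A s \<Longrightarrow> cost s (near s) \<le> cost s z"
    and far: "\<And>s. far s \<in> A s" "\<And>s z. z \<in> A s \<Longrightarrow> cost s z \<le> cost s (far s)"
    by metis
  define lo_cost hi_cost where "lo_cost = (\<Sum>s\<in>UNIV. prb D s * cost s (near s))"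
    and "hi_cost = (\<Sum>s\<in>UNIV. prb D s * cost s (far s))"
  have "0 \<le> dual_value (\<lambda>s. - (prb D s * cost s (near s))) 1"
    using near(2) prb_nonneg by (intro improving) (auto simp: A_def cost_def mult_left_mono)
  then have lo_le: "lo_cost \<le> radius D"
    by (simp add: dual_value_def lo_cost_def sum_negf)
  have le_hi: "radius D \<le> hi_cost" if "\<beta> \<noteq> 0"
  proof -
    have "0 \<le> dual_value (\<lambda>s. prb D s * cost s (far s)) (- 1)"
      using far(2) prb_nonneg that by (intro improving) (auto simp: A_def cost_def mult_left_mono)
    then show ?thesis by (simp add: dual_value_def hi_cost_def)
  qed
  obtain t where t: "0 \<le> t" "t \<le> 1" "(1 - t) * lo_cost + t * hi_cost \<le> radius D"
      "\<beta> * ((1 - t) * lo_cost + t * hi_cost) = \<beta> * radius D"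
  proof (cases "\<beta> = 0 \<or> lo_cost = radius D")
    case True
    then show ?thesis using lo_le by (intro that[of 0]) auto
  next
    case False
    then have lt: "lo_cost < radius D" "radius D \<le> hi_cost" using lo_le le_hi by auto
    define t where "t = (radius D - lo_cost) / (hi_cost - lo_cost)"
    have "t * (hi_cost - lo_cost) = radius D - lo_cost" using lt by (simp add: t_def)
    then have "(1 - t) * lo_cost + t * hi_cost = radius D" by (simp add: algebra_simps)
    moreover have "0 \<le> t" "t \<le> 1" using lt by (simp_all add: t_def)
    ultimately show ?thesis by (intro that[of t]) auto
  qed
  define p where "p s \<xi> = (1 - t) * of_bool (\<xi> = near s) + t * of_bool (\<xi> = far s)" for s \<xi>
  have sum_p: "(\<Sum>\<xi>\<in>\<Omega> s. g \<xi> * p s \<xi>) = (1 - t) * g (near s) + t * g (far s)" for s and g :: "_ \<Rightarrow> real"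
  proof -
    have "near s \<in> \<Omega> s" "far s \<in> \<Omega> s" using near(1)[of s] far(1)[of s] by (auto simp: A_def)
    moreover have "g \<xi> * p s \<xi> = (if \<xi> = near s then (1 - t) * g \<xi> else 0) + (if \<xi> = far s then t * g \<xi> else 0)" for \<xi>
      by (simp add: p_def algebra_simps)
    ultimately show ?thesis
      using fin[of s] by (simp add: sum.distrib)
  qed
  have cost_p: "(\<Sum>s\<in>UNIV. prb D s * (\<Sum>\<xi>\<in>\<Omega> s. l1 (\<xi> - smp D s) * p s \<xi>)) =
      (1 - t) * lo_cost + t * hi_cost"
    unfolding sum_p[of "\<lambda>\<xi>. l1 (\<xi> - smp D _)"] lo_cost_def hi_cost_def cost_def
    by (simp add: sum.distrib sum_subtractf sum_distrib_left algebra_simps)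
  have "pricing_master_feasible D \<Omega> p"
    unfolding pricing_master_feasible_def cost_p using t sum_p[of "\<lambda>_. 1"] by (simp add: p_def)
  moreover have "primal_value x \<Omega> p = dual_value \<alpha> \<beta>"
  proof -
    have act: "prb D s * Q D x z = \<alpha> s + \<beta> * (prb D s * cost s z)" if "z \<in> A s" for s z
      using that by (simp add: A_def cost_def algebra_simps)
    have "(\<Sum>\<xi>\<in>\<Omega> s. prb D s * Q D x \<xi> * p s \<xi>) =
        \<alpha> s + \<beta> * ((1 - t) * (prb D s * cost s (near s)) + t * (prb D s * cost s (far s)))" for s
      unfolding sum_p act[OF near(1)] act[OF far(1)] by (simp add: algebra_simps)
    then have "primal_value x \<Omega> p = (\<Sum>s\<in>UNIV. \<alpha> s) + \<beta> * ((1 - t) * lo_cost + t * hi_cost)"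
      unfolding primal_value_def lo_cost_def hi_cost_def
      by (simp add: sum.distrib flip: sum_distrib_left)
    then show ?thesis using t(4) by (simp add: dual_value_def mult.commute)
  qed
  ultimately show ?thesis by blast
qed

lemma pricing_master_value_eq_dual_value:
  assumes m: "multipliers_optimal D x \<Omega> \<alpha> \<beta>" and fin: "\<And>s. finite (\<Omega> s)"
  shows "pricing_master_value D x \<Omega> = dual_value \<alpha> \<beta>"
proof -
  obtain p where p: "pricing_master_feasible D \<Omega> p" "primal_value x \<Omega> p = dual_value \<alpha> \<beta>"
    using strong_duality[OF m fin] by blast
  have "multipliers_feasible D x \<Omega> \<alpha> \<beta>" using m by (simp add: multipliers_optimal_def)
  then have "primal_value x \<Omega> q \<le> dual_value \<alpha> \<beta>" if "pricing_master_feasible D \<Omega> q" for q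
    using weak_duality that by blast
  then show ?thesis
    unfolding pricing_master_value_def primal_value_def[symmetric] using p
    by (intro cSup_eq_maximum) (auto intro!: image_eqI[of _ _ p])
qed

section \<open>Distributions in the ambiguity set\<close>

abbreviation Xi_space :: "(real ^ 'm) measure" where
  "Xi_space \<equiv> sigma (Xi D) (salg D)"

lemma sets_Xi_space [simp]: "sets Xi_space = salg D"
  using salg by (simp add: sigma_algebra.sets_measure_of_eq)

lemma space_Xi_space [simp]: "space Xi_space = Xi D"
  using salg by (simp add: sigma_algebra.space_measure_of_eq)

text \<open>As the image of a discrete measure on the samples, the formula in the definition is
  countably additive. Several samples may share a location, and the image adds up their weights.\<close>

lemma empirical_eq_distr:
  "empirical D = distr (point_measure UNIV (\<lambda>s. ennreal (prb D s))) Xi_space (smp D)"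
proof -
  let ?P = "distr (point_measure UNIV (\<lambda>s. ennreal (prb D s))) Xi_space (smp D)"
  let ?f = "\<lambda>E. \<Sum>s\<in>UNIV. ennreal (prb D s) * indicator E (smp D s)"
  have em: "emeasure ?P E = ?f E" if "E \<in> salg D" for E
  proof -
    have "emeasure ?P E = (\<Sum>s\<in>smp D -` E. ennreal (prb D s))"
      using that samples
      by (subst emeasure_distr) (auto simp: emeasure_point_measure_finite space_point_measure)
    also have "\<dots> = ?f E"
      by (intro sum.mono_neutral_cong_left) (auto simp: indicator_def)
    finally show ?thesis .
  qed
  have "salg D \<subseteq> Pow (Xi D)"
    using sets.space_closed[of Xi_space] by simp
  then have "empirical D = measure_of (Xi D) (salg D) (emeasure ?P)"
    unfolding empirical_def using salg em
    by (intro measure_of_eq) (simp_all add: sigma_algebra.sigma_sets_eq)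
  also have "\<dots> = measure_of (space ?P) (sets ?P) (emeasure ?P)"
    by simp
  also have "\<dots> = ?P" by (rule measure_of_of_measure)
  finally show ?thesis .
qed

lemma sets_empirical [simp]: "sets (empirical D) = salg D"
  and space_empirical [simp]: "space (empirical D) = Xi D"
  by (simp_all add: empirical_eq_distr)

lemma borel_sets_salg:
  assumes "E \<in> sets borel" "E \<subseteq> Xi D"
  shows "E \<in> salg D"
proof -
  have "E \<in> sets (restrict_space borel (Xi D))"
    using assms by (subst sets_restrict_space_iff) (auto simp: Xi_cbox)
  then show ?thesis using borel by blast
qed

lemma borel_measurable_Xi:
  assumes "f \<in> borel_measurable borel" "sets P = salg D" "space P = Xi D"
  shows "f \<in> measurable P borel"
proof -
  have "f \<in> borel_measurable (restrict_space borel (Xi D))"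
    using assms(1) by (rule measurable_restrict_space1)
  then show ?thesis
    using assms(2,3) borel unfolding measurable_def by (auto simp: space_restrict_space)
qed

lemma transport_cost_measurable:
  assumes "sets \<gamma> = sets (P \<Otimes>\<^sub>M P')" "sets P = salg D" "space P = Xi D" "sets P' = salg D" "space P' = Xi D"
  shows "(\<lambda>z. l1 (fst z - snd z)) \<in> borel_measurable \<gamma>"
proof -
  have "fst \<in> measurable \<gamma> P" "snd \<in> measurable \<gamma> P'"
    using measurable_cong_sets[OF assms(1) refl] by auto
  moreover have "(\<lambda>\<xi>. \<xi>) \<in> borel_measurable P" "(\<lambda>\<xi>. \<xi>) \<in> borel_measurable P'"
    by (intro borel_measurable_Xi[OF _ assms(2,3)] borel_measurable_Xi[OF _ assms(4,5)], simp)+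
  ultimately have "fst \<in> borel_measurable \<gamma>" "snd \<in> borel_measurable \<gamma>"
    by (auto dest: measurable_compose)
  then have "(\<lambda>z. fst z - snd z) \<in> borel_measurable \<gamma>"
    by (rule borel_measurable_diff)
  moreover have "l1 \<in> borel_measurable (borel :: (real ^ 'm) measure)"
    unfolding l1_def by (intro borel_measurable_continuous_onI continuous_intros)
  ultimately show ?thesis by (rule measurable_compose)
qed

lemma prob_space_point_measure:
  assumes "finite I" "\<And>i. i \<in> I \<Longrightarrow> 0 \<le> w i" "(\<Sum>i\<in>I. w i) = (1::real)"
  shows "prob_space (point_measure I (\<lambda>i. ennreal (w i)))"
  using assms by (intro prob_spaceI)
    (simp add: space_point_measure emeasure_point_measure_finite sum_ennreal)

lemma integral_empirical:
  assumes "f \<in> borel_measurable Xi_space"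
  shows "(\<integral>\<xi>. f \<xi> \<partial>empirical D) = (\<Sum>s\<in>UNIV. prb D s * f (smp D s))"
proof -
  have "(\<integral>\<xi>. f \<xi> \<partial>empirical D) =
      (\<integral>s. f (smp D s) \<partial>point_measure UNIV (\<lambda>s. ennreal (prb D s)))"
    unfolding empirical_eq_distr using samples assms by (subst integral_distr) auto
  also have "\<dots> = (\<Sum>s\<in>UNIV. prb D s * f (smp D s))"
    using prb_nonneg by (subst lebesgue_integral_point_measure_finite) (auto simp: scaleR_conv_of_real)
  finally show ?thesis .
qed

text \<open>Lets integrands over the empirical distribution be changed away from the samples.\<close>

lemma AE_empirical_sample: "AE \<xi> in empirical D. \<xi> \<in> range (smp D)"
proof -
  have "range (smp D) \<in> salg D"
    using samples by (intro borel_sets_salg) (auto intro!: borel_closed finite_imp_closed)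
  moreover have "{\<xi> \<in> Xi D. \<xi> \<in> range (smp D)} = range (smp D)"
    using samples by auto
  ultimately show ?thesis
    unfolding empirical_eq_distr using samples by (subst AE_distr_iff) auto
qed

text \<open>A feasible \<open>p\<close> sends the share \<open>p s \<xi>\<close> of the mass of sample \<open>s\<close> to \<open>\<xi>\<close>. This transport plan is a
  discrete measure on pairs of a sample and a scenario, of which the mixture and its coupling with the
  empirical distribution are both images. One and the same mixture serves all first-stage decisions.\<close>

lemma mixture_in_ambiguity:
  assumes p: "pricing_master_feasible D \<Omega> p" and sub: "\<And>s. \<Omega> s \<subseteq> Xi D"
  shows "\<exists>P\<in>ambiguity D. \<forall>x\<in>first_stage D. (\<integral>\<xi>. Q D x \<xi> \<partial>P) = primal_value x \<Omega> p"
proof -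
  define I where "I = Sigma UNIV \<Omega>"
  define w where "w = (\<lambda>(s, \<xi>). prb D s * p s \<xi>)"
  define N where "N = point_measure I (\<lambda>i. ennreal (w i))"
  define P where "P = distr N Xi_space snd"
  define \<gamma> where "\<gamma> = distr N (Xi_space \<Otimes>\<^sub>M Xi_space) (\<lambda>i. (snd i, smp D (fst i)))"
  note fin = pricing_master_feasible_finite[OF p]
  have finI: "finite I" unfolding I_def using fin by auto
  have w0: "0 \<le> w i" if "i \<in> I" for i
    using that p prb_nonneg by (auto simp: I_def w_def pricing_master_feasible_def)
  have sum_I: "(\<Sum>i\<in>I. w i * g i) = (\<Sum>s\<in>UNIV. \<Sum>\<xi>\<in>\<Omega> s. prb D s * p s \<xi> * g (s, \<xi>))" for g :: "_ \<Rightarrow> real"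
    unfolding I_def w_def using fin by (subst sum.Sigma) (simp_all add: case_prod_beta)
  have p1: "(\<Sum>\<xi>\<in>\<Omega> s. p s \<xi>) = 1" for s
    using p by (simp add: pricing_master_feasible_def)
  have "(\<Sum>i\<in>I. w i) = 1"
    using sum_I[of "\<lambda>_. 1"] by (simp add: p1 prb_sum flip: sum_distrib_left)
  then have "prob_space N"
    unfolding N_def using finI w0 by (intro prob_space_point_measure)
  have snd_N: "snd \<in> measurable N Xi_space"
    unfolding N_def by (auto simp: I_def dest: subsetD[OF sub])
  have pair_N: "(\<lambda>i. (snd i, smp D (fst i))) \<in> measurable N (Xi_space \<Otimes>\<^sub>M Xi_space)"
    unfolding N_def using samples by (auto simp: I_def space_pair_measure dest: subsetD[OF sub])
  have "P \<in> distributions D"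
    using prob_space.prob_space_distr[OF \<open>prob_space N\<close> snd_N] by (simp add: distributions_def P_def)
  have setsP: "sets P = salg D" by (simp add: P_def)
  have cong: "sets (Xi_space \<Otimes>\<^sub>M Xi_space) = sets (P \<Otimes>\<^sub>M empirical D)"
    by (intro sets_pair_measure_cong) (simp_all add: setsP)
  have "\<gamma> \<in> couplings P (empirical D)"
  proof -
    have "distr \<gamma> P fst = distr \<gamma> Xi_space fst"
      by (intro distr_cong) (simp_all add: setsP)
    also have "\<dots> = P"
      unfolding \<gamma>_def P_def by (subst distr_distr[OF _ pair_N]) (simp_all add: o_def)
    finally have "distr \<gamma> P fst = P" .
    moreover have "distr \<gamma> (empirical D) snd = empirical D"
    proof -
      have "distr \<gamma> (empirical D) snd = distr \<gamma> Xi_space snd"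
        by (intro distr_cong) simp_all
      also have "\<dots> = distr N Xi_space (\<lambda>i. smp D (fst i))"
        unfolding \<gamma>_def by (subst distr_distr[OF _ pair_N]) (simp_all add: o_def)
      also have "\<dots> = empirical D"
      proof (rule measure_eqI)
        fix E assume "E \<in> sets (distr N Xi_space (\<lambda>i. smp D (fst i)))"
        then have E: "E \<in> salg D" by simp
        have "emeasure (distr N Xi_space (\<lambda>i. smp D (fst i))) E =
            (\<Sum>i\<in>{i\<in>I. smp D (fst i) \<in> E}. ennreal (w i))"
          unfolding N_def using E samples finI
          by (subst emeasure_distr)
            (auto simp: emeasure_point_measure_finite space_point_measure intro!: sum.cong)
        also have "\<dots> = ennreal (\<Sum>i\<in>{i\<in>I. smp D (fst i) \<in> E}. w i)"
          using w0 by (intro sum_ennreal) auto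
        also have "(\<Sum>i\<in>{i\<in>I. smp D (fst i) \<in> E}. w i) = (\<Sum>i\<in>I. w i * indicator E (smp D (fst i)))"
          using finI by (intro sum.mono_neutral_cong_left) (auto simp: indicator_def)
        also have "\<dots> = (\<Sum>s\<in>UNIV. prb D s * indicator E (smp D s))"
          unfolding sum_I by (simp add: p1 flip: sum_distrib_right sum_distrib_left)
        also have "ennreal \<dots> = (\<Sum>s\<in>UNIV. ennreal (prb D s) * indicator E (smp D s))"
          using prb_nonneg
          by (subst sum_ennreal[symmetric]) (auto simp: indicator_def intro!: sum.cong)
        also have "\<dots> = (\<Sum>s\<in>smp D -` E. ennreal (prb D s))"
          by (intro sum.mono_neutral_cong_right) (auto simp: indicator_def)
        also have "\<dots> = emeasure (empirical D) E"
          unfolding empirical_eq_distr using E samples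
          by (subst emeasure_distr) (auto simp: emeasure_point_measure_finite space_point_measure)
        finally show "emeasure (distr N Xi_space (\<lambda>i. smp D (fst i))) E = emeasure (empirical D) E" .
      qed simp
      finally show ?thesis .
    qed
    ultimately show ?thesis
      by (simp add: couplings_def \<gamma>_def flip: cong)
  qed
  moreover have "(\<integral>\<^sup>+z. ennreal (l1 (fst z - snd z)) \<partial>\<gamma>) \<le> ennreal (radius D)"
  proof -
    have l1_0: "0 \<le> l1 u" for u :: "real ^ 'm" by (simp add: l1_def sum_nonneg)
    have "(\<integral>\<^sup>+z. ennreal (l1 (fst z - snd z)) \<partial>\<gamma>) =
        (\<integral>\<^sup>+i. ennreal (l1 (snd i - smp D (fst i))) \<partial>N)"
      unfolding \<gamma>_def
      by (subst nn_integral_distr[OF pair_N]) (auto intro!: measurable_compose[OF _ measurable_ennreal] transport_cost_measurable)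
    also have "\<dots> = (\<Sum>i\<in>I. ennreal (w i) * ennreal (l1 (snd i - smp D (fst i))))"
      unfolding N_def using finI by (rule nn_integral_point_measure_finite)
    also have "\<dots> = ennreal (\<Sum>i\<in>I. w i * l1 (snd i - smp D (fst i)))"
      using w0 l1_0 by (subst sum_ennreal[symmetric]) (auto simp: ennreal_mult)
    also have "(\<Sum>i\<in>I. w i * l1 (snd i - smp D (fst i))) =
        (\<Sum>s\<in>UNIV. prb D s * (\<Sum>\<xi>\<in>\<Omega> s. l1 (\<xi> - smp D s) * p s \<xi>))"
      unfolding sum_I by (simp add: sum_distrib_left mult_ac)
    also have "ennreal \<dots> \<le> ennreal (radius D)"
      using p by (intro ennreal_leI) (simp add: pricing_master_feasible_def)
    finally show ?thesis .
  qed
  ultimately have "wasserstein P (empirical D) \<le> ennreal (radius D)"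
    unfolding wasserstein_def by (rule INF_lower2)
  then have "P \<in> ambiguity D"
    using \<open>P \<in> distributions D\<close> by (simp add: ambiguity_def)
  moreover have "(\<integral>\<xi>. Q D x \<xi> \<partial>P) = primal_value x \<Omega> p" if x: "x \<in> first_stage D" for x
  proof -
    have "(\<integral>\<xi>. Q D x \<xi> \<partial>P) = (\<integral>i. Q D x (snd i) \<partial>N)"
      unfolding P_def using borel by (intro integral_distr snd_N Q_measurable[OF x]) auto
    also have "\<dots> = (\<Sum>i\<in>I. w i * Q D x (snd i))"
      unfolding N_def using finI w0 by (subst lebesgue_integral_point_measure_finite) auto
    also have "\<dots> = primal_value x \<Omega> p"
      unfolding sum_I primal_value_def by (simp add: mult_ac)
    finally show ?thesis .
  qed
  ultimately show ?thesis by blast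
qed

text \<open>For a coupling, the recourse cost at the target is at most the transport penalty plus the
  largest penalised recourse cost \<open>f\<close> at the source. At a sample this supremum is bounded through
  \<open>\<alpha>\<close>. Integrate and let the transport cost of the coupling tend to the radius; the infimum in the
  Wasserstein distance is only approached here.\<close>

lemma expectation_le_dual_value:
  assumes x: "x \<in> first_stage D" and P: "P \<in> ambiguity D"
    and m: "multipliers_feasible D x (\<lambda>s. Xi D) \<alpha> \<beta>"
  shows "(\<integral>\<xi>. Q D x \<xi> \<partial>P) \<le> dual_value \<alpha> \<beta>"
proof -
  have \<beta>: "0 \<le> \<beta>"
    and le: "\<And>s \<xi>. \<xi> \<in> Xi D \<Longrightarrow> prb D s * Q D x \<xi> \<le> \<alpha> s + prb D s * l1 (\<xi> - smp D s) * \<beta>"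
    using m by (auto simp: multipliers_feasible_def)
  have P: "prob_space P" "space P = Xi D" "sets P = salg D"
    and W: "wasserstein P (empirical D) \<le> ennreal (radius D)"
    using P by (auto simp: ambiguity_def distributions_def)
  obtain B where B: "0 \<le> B" "\<And>\<xi>. \<xi> \<in> Xi D \<Longrightarrow> \<bar>Q D x \<xi>\<bar> \<le> B"
    using Q_bounded[OF x] by blast
  define f where "f \<zeta> = Sup ((\<lambda>\<xi>. Q D x \<xi> - \<beta> * l1 (\<xi> - \<zeta>)) ` Xi D)" for \<zeta>
  \<comment> \<open>\<open>h\<close> agrees with \<open>f\<close> at the samples and vanishes elsewhere, so that it is measurable.\<close>
  define h where "h \<zeta> = (\<Sum>z\<in>range (smp D). f z * indicator {z} \<zeta>)" for \<zeta>
  have l1_0: "0 \<le> l1 u" for u :: "real ^ 'm" by (simp add: l1_def sum_nonneg)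
  have f_upper: "Q D x \<xi> - \<beta> * l1 (\<xi> - \<zeta>) \<le> f \<zeta>" if "\<xi> \<in> Xi D" for \<xi> \<zeta>
    unfolding f_def
  proof (rule cSup_upper)
    show "bdd_above ((\<lambda>\<xi>. Q D x \<xi> - \<beta> * l1 (\<xi> - \<zeta>)) ` Xi D)"
    proof (rule bdd_aboveI2)
      fix \<xi> assume "\<xi> \<in> Xi D"
      then show "Q D x \<xi> - \<beta> * l1 (\<xi> - \<zeta>) \<le> B"
        using B(2)[of \<xi>] mult_nonneg_nonneg[OF \<beta> l1_0[of "\<xi> - \<zeta>"]] by linarith
    qed
  qed (use that in auto)
  have f_le: "prb D s * f (smp D s) \<le> \<alpha> s" for s
  proof (cases "prb D s = 0")
    case True
    then show ?thesis using le[OF samples, of s s] by simp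
  next
    case False
    then have "0 < prb D s" using prb_nonneg[of s] by simp
    have "f (smp D s) \<le> \<alpha> s / prb D s"
      unfolding f_def
    proof (rule cSup_least)
      fix t assume "t \<in> (\<lambda>\<xi>. Q D x \<xi> - \<beta> * l1 (\<xi> - smp D s)) ` Xi D"
      then obtain \<xi> where \<xi>: "\<xi> \<in> Xi D" and t: "t = Q D x \<xi> - \<beta> * l1 (\<xi> - smp D s)" by auto
      have "prb D s * t = prb D s * Q D x \<xi> - prb D s * l1 (\<xi> - smp D s) * \<beta>"
        unfolding t by (simp add: algebra_simps)
      then have "prb D s * t \<le> \<alpha> s"
        using le[OF \<xi>, of s] by linarith
      then show "t \<le> \<alpha> s / prb D s"
        using \<open>0 < prb D s\<close> by (simp add: pos_le_divide_eq mult.commute)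
    qed (use samples in auto)
    then show ?thesis using \<open>0 < prb D s\<close> by (simp add: field_simps)
  qed
  have h_smp: "h z = f z" if "z \<in> range (smp D)" for z
    using that unfolding h_def by (subst sum.remove[of _ z]) (auto simp: indicator_def)
  have h_meas: "h \<in> borel_measurable borel"
    unfolding h_def by measurable
  have h_bdd: "\<bar>h z\<bar> \<le> (\<Sum>z\<in>range (smp D). \<bar>f z\<bar>)" for z
    unfolding h_def by (rule order_trans[OF sum_abs]) (intro sum_mono, auto simp: indicator_def)
  have sum_h: "(\<integral>\<xi>. h \<xi> \<partial>empirical D) \<le> (\<Sum>s\<in>UNIV. \<alpha> s)"
    using f_le by (subst integral_empirical) (auto intro!: sum_mono borel_measurable_Xi h_meas simp: h_smp)
  have bound: "(\<integral>\<xi>. Q D x \<xi> \<partial>P) \<le> (\<Sum>s\<in>UNIV. \<alpha> s) + \<beta> * t" if t: "radius D < t" for t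
  proof -
    have "wasserstein P (empirical D) < ennreal t"
      using W t radius by (meson ennreal_lessI le_less_trans order_le_less_trans)
    then obtain \<gamma> where \<gamma>: "\<gamma> \<in> couplings P (empirical D)"
        "(\<integral>\<^sup>+z. ennreal (l1 (fst z - snd z)) \<partial>\<gamma>) < ennreal t"
      unfolding wasserstein_def by (auto simp: INF_less_iff)
    have sets\<gamma>: "sets \<gamma> = sets (P \<Otimes>\<^sub>M empirical D)"
      and fst\<gamma>: "distr \<gamma> P fst = P" and snd\<gamma>: "distr \<gamma> (empirical D) snd = empirical D"
      using \<gamma>(1) by (auto simp: couplings_def)
    have space\<gamma>: "space \<gamma> = Xi D \<times> Xi D"
      using sets_eq_imp_space_eq[OF sets\<gamma>] P by (simp add: space_pair_measure)
    have fst_m: "fst \<in> measurable \<gamma> P" and snd_m: "snd \<in> measurable \<gamma> (empirical D)"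
      using measurable_cong_sets[OF sets\<gamma> refl] by auto
    have "prob_space \<gamma>"
      using P(1) fst\<gamma> prob_space_distrD[OF fst_m] by simp
    then interpret \<gamma>: prob_space \<gamma> .
    have Q_m: "Q D x \<in> borel_measurable P"
      using borel P by (intro Q_measurable[OF x]) auto
    have h_m: "h \<in> borel_measurable (empirical D)"
      by (rule borel_measurable_Xi[OF h_meas]) simp_all
    have l1_m: "(\<lambda>z. l1 (fst z - snd z)) \<in> borel_measurable \<gamma>"
      by (rule transport_cost_measurable[OF sets\<gamma> P(3,2)]) simp_all
    obtain M where M: "\<And>z. z \<in> space \<gamma> \<Longrightarrow> l1 (fst z - snd z) \<le> M"
    proof
      fix z assume "z \<in> space \<gamma>"
      then have "fst z \<in> Xi D" "snd z \<in> Xi D" by (auto simp: space\<gamma>)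
      then have "lo D $ i \<le> fst z $ i \<and> fst z $ i \<le> hi D $ i"
          "lo D $ i \<le> snd z $ i \<and> snd z $ i \<le> hi D $ i" for i
        by (simp_all add: in_Xi_iff)
      then have "\<bar>(fst z - snd z) $ i\<bar> \<le> hi D $ i - lo D $ i" for i
        unfolding vector_minus_component by (smt (verit))
      then show "l1 (fst z - snd z) \<le> (\<Sum>i\<in>UNIV. hi D $ i - lo D $ i)"
        unfolding l1_def by (intro sum_mono)
    qed
    have int_Q: "integrable \<gamma> (\<lambda>z. Q D x (fst z))"
      using B space\<gamma> measurable_compose[OF fst_m Q_m]
      by (intro \<gamma>.integrable_const_bound[of _ B]) auto
    have int_h: "integrable \<gamma> (\<lambda>z. h (snd z))"
      using h_bdd measurable_compose[OF snd_m h_m] by (intro \<gamma>.integrable_const_bound) auto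
    have int_l1: "integrable \<gamma> (\<lambda>z. l1 (fst z - snd z))"
      using M l1_0 l1_m by (intro \<gamma>.integrable_const_bound[of _ M]) auto
    have "AE z in \<gamma>. snd z \<in> range (smp D)"
      using AE_distrD[OF snd_m, of "\<lambda>\<zeta>. \<zeta> \<in> range (smp D)"] AE_empirical_sample
      unfolding snd\<gamma> by blast
    then have ae: "AE z in \<gamma>. Q D x (fst z) \<le> h (snd z) + \<beta> * l1 (fst z - snd z)"
    proof (rule AE_mp[OF _ AE_I2], intro impI)
      fix z assume "z \<in> space \<gamma>" "snd z \<in> range (smp D)"
      then show "Q D x (fst z) \<le> h (snd z) + \<beta> * l1 (fst z - snd z)"
        using f_upper[of "fst z" "snd z"] by (auto simp: space\<gamma> h_smp)
    qed
    have "(\<integral>\<xi>. Q D x \<xi> \<partial>P) = (\<integral>z. Q D x (fst z) \<partial>\<gamma>)"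
      using integral_distr[OF fst_m Q_m] by (simp add: fst\<gamma>)
    also have "\<dots> \<le> (\<integral>z. h (snd z) + \<beta> * l1 (fst z - snd z) \<partial>\<gamma>)"
      using ae int_Q int_h int_l1 by (intro integral_mono_AE) auto
    also have "\<dots> = (\<integral>z. h (snd z) \<partial>\<gamma>) + \<beta> * (\<integral>z. l1 (fst z - snd z) \<partial>\<gamma>)"
      using int_h int_l1 by simp
    finally have "(\<integral>\<xi>. Q D x \<xi> \<partial>P) \<le>
        (\<integral>z. h (snd z) \<partial>\<gamma>) + \<beta> * (\<integral>z. l1 (fst z - snd z) \<partial>\<gamma>)" .
    moreover have "(\<integral>z. h (snd z) \<partial>\<gamma>) = (\<integral>\<xi>. h \<xi> \<partial>empirical D)"
      using integral_distr[OF snd_m h_m] by (simp add: snd\<gamma>)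
    moreover have "\<beta> * (\<integral>z. l1 (fst z - snd z) \<partial>\<gamma>) \<le> \<beta> * t"
    proof (rule mult_left_mono[OF _ \<beta>])
      have "ennreal (\<integral>z. l1 (fst z - snd z) \<partial>\<gamma>) = (\<integral>\<^sup>+z. ennreal (l1 (fst z - snd z)) \<partial>\<gamma>)"
        using int_l1 l1_0 by (intro nn_integral_eq_integral[symmetric]) auto
      with \<gamma>(2) have "ennreal (\<integral>z. l1 (fst z - snd z) \<partial>\<gamma>) < ennreal t" by simp
      then show "(\<integral>z. l1 (fst z - snd z) \<partial>\<gamma>) \<le> t"
        by (meson ennreal_leI leD le_cases)
    qed
    ultimately show ?thesis using sum_h by linarith
  qed
  have "(\<integral>\<xi>. Q D x \<xi> \<partial>P) - (\<Sum>s\<in>UNIV. \<alpha> s) \<le> \<beta> * radius D"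
  proof (rule tendsto_lowerbound)
    show "((\<lambda>t. \<beta> * t) \<longlongrightarrow> \<beta> * radius D) (at_right (radius D))" by (intro tendsto_intros)
    show "\<forall>\<^sub>F t in at_right (radius D). (\<integral>\<xi>. Q D x \<xi> \<partial>P) - (\<Sum>s\<in>UNIV. \<alpha> s) \<le> \<beta> * t"
      using eventually_at_right_less[of "radius D"]
      by (rule eventually_mono) (use bound in \<open>simp add: diff_le_eq add.commute\<close>)
  qed simp
  then show ?thesis by (simp add: dual_value_def mult.commute)
qed

section \<open>The inner column generation\<close>

text \<open>The supremum in \<open>v\<close> is over a set of reals that is bounded above: \<open>\<beta> = 0\<close> and a bound on the
  recourse function give multipliers for the whole box.\<close>

lemma v_upper:
  assumes "x \<in> first_stage D" "P \<in> ambiguity D"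
  shows "(\<integral>\<xi>. Q D x \<xi> \<partial>P) \<le> v D x"
proof -
  obtain B where B: "\<And>\<xi>. \<xi> \<in> Xi D \<Longrightarrow> \<bar>Q D x \<xi>\<bar> \<le> B"
    using Q_bounded[OF assms(1)] by blast
  have "prb D s * Q D x \<xi> \<le> prb D s * B" if "\<xi> \<in> Xi D" for s \<xi>
    using B[OF that] prb_nonneg by (intro mult_left_mono) auto
  then have "multipliers_feasible D x (\<lambda>s. Xi D) (\<lambda>s. prb D s * B) 0"
    by (simp add: multipliers_feasible_def)
  then have "bdd_above ((\<lambda>P. \<integral>\<xi>. Q D x \<xi> \<partial>P) ` ambiguity D)"
    using expectation_le_dual_value[OF assms(1)] by (intro bdd_aboveI2) blast
  then show ?thesis
    unfolding v_def using assms(2) by (rule cSUP_upper2) simp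
qed

lemma v_le_dual_value:
  assumes "x \<in> first_stage D" "multipliers_feasible D x (\<lambda>s. Xi D) \<alpha> \<beta>"
  shows "v D x \<le> dual_value \<alpha> \<beta>"
proof -
  have "pricing_master_feasible D (\<lambda>s. {smp D s}) (\<lambda>s \<xi>. 1)"
    using radius by (simp add: pricing_master_feasible_def l1_def)
  \<comment> \<open>Leaving all mass at the samples is feasible for every radius.\<close>
  then have "ambiguity D \<noteq> {}"
    using mixture_in_ambiguity[of "\<lambda>s. {smp D s}"] samples by fastforce
  then show ?thesis
    unfolding v_def using expectation_le_dual_value assms by (intro cSUP_least) auto
qed

lemma primal_value_le_v:
  assumes "x \<in> first_stage D" "pricing_master_feasible D \<Omega> p" "\<And>s. \<Omega> s \<subseteq> Xi D"
  shows "primal_value x \<Omega> p \<le> v D x"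
  using mixture_in_ambiguity[OF assms(2,3)] v_upper[OF assms(1)] assms(1) by metis

lemma candidate_argmax:
  assumes x: "x \<in> first_stage D"
  shows "\<exists>z\<in>candidates D s. is_arg_max (reduced_cost D x \<alpha> \<beta> s) (\<lambda>\<xi>. \<xi> \<in> Xi D) z"
proof -
  let ?f = "reduced_cost D x \<alpha> \<beta> s"
  have "Max (?f ` candidates D s) \<in> ?f ` candidates D s"
    using finite_candidates sample_in_candidates by (intro Max_in) auto
  then obtain z where z: "z \<in> candidates D s" "?f z = Max (?f ` candidates D s)" by auto
  have "?f \<xi> \<le> ?f z" if \<xi>: "\<xi> \<in> Xi D" for \<xi>
  proof -
    obtain z' where z': "z' \<in> candidates D s"
        "Q D x \<xi> - \<beta> * l1 (\<xi> - smp D s) \<le> Q D x z' - \<beta> * l1 (z' - smp D s)"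
      using candidate_dominates[OF x \<xi>] by blast
    have "?f \<xi> \<le> ?f z'"
      unfolding reduced_cost_def using z'(2) prb_nonneg by (intro diff_right_mono mult_left_mono) auto
    also have "\<dots> \<le> ?f z"
      unfolding z(2) using z'(1) finite_candidates by (intro Max_ge) auto
    finally show ?thesis .
  qed
  then show ?thesis
    using z(1) candidates_subset_Xi by (intro bexI[of _ z]) (auto simp: is_arg_max_def not_less)
qed

text \<open>Scenarios that are already present have nonpositive reduced cost, since the multipliers satisfy
  their constraints; a scenario that is added has positive reduced cost and is therefore new.\<close>

lemma cg_step_grows:
  assumes "cg_step D x \<Omega> \<Omega>'" "\<And>s. \<Omega> s \<subseteq> candidates D s"
  shows "(\<forall>s. \<Omega> s \<subseteq> \<Omega>' s) \<and> (\<forall>s. \<Omega>' s \<subseteq> candidates D s) \<and> \<Omega>' \<noteq> \<Omega>"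
  using assms(1)
proof cases
  case phase1
  then show ?thesis by blast
next
  case (price \<alpha> \<beta> z)
  have m: "multipliers_feasible D x \<Omega> \<alpha> \<beta>" and z: "\<And>s. z s \<in> candidates D s"
    using price(2) by (auto simp: cg_priced_def multipliers_optimal_def)
  obtain s where s: "0 < reduced_cost D x \<alpha> \<beta> s (z s)" using price(3) by blast
  have "z s \<notin> \<Omega> s"
  proof
    assume "z s \<in> \<Omega> s"
    then have "prb D s * Q D x (z s) \<le> \<alpha> s + prb D s * l1 (z s - smp D s) * \<beta>"
      using m by (simp add: multipliers_feasible_def)
    with s show False by (simp add: reduced_cost_def algebra_simps)
  qed
  moreover have "z s \<in> \<Omega>' s" using s price(1) by simp
  ultimately have "\<Omega>' \<noteq> \<Omega>" by blast
  then show ?thesis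
    using price(1) z assms(2) by auto
qed

lemma cg_reaches_candidates:
  assumes "cg_reaches D x \<Omega>"
  shows "\<Omega> s \<subseteq> candidates D s"
proof -
  have "\<forall>s. \<Omega> s \<subseteq> candidates D s"
    using assms unfolding cg_reaches_def
  proof (induction rule: rtranclp_induct)
    case (step \<Omega> \<Omega>')
    then show ?case using cg_step_grows by blast
  qed simp
  then show ?thesis by blast
qed

definition scenario_count :: "('s \<Rightarrow> (real ^ 'm) set) \<Rightarrow> nat" where
  "scenario_count \<Omega> = (\<Sum>s\<in>UNIV. card (\<Omega> s))"

lemma scenario_count_le:
  assumes "\<And>s. \<Omega> s \<subseteq> candidates D s"
  shows "scenario_count \<Omega> \<le> 3 ^ CARD('m) * CARD('s)"
proof -
  have "card (\<Omega> s) \<le> 3 ^ CARD('m)" for s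
    using card_mono[OF finite_candidates assms] card_candidates order_trans by blast
  then have "scenario_count \<Omega> \<le> (\<Sum>s\<in>(UNIV :: 's set). 3 ^ CARD('m))"
    unfolding scenario_count_def by (intro sum_mono)
  then show ?thesis by (simp add: mult.commute)
qed

lemma scenario_count_less:
  assumes "\<And>s. \<Omega> s \<subseteq> \<Omega>' s" "\<Omega> \<noteq> \<Omega>'" "\<And>s. \<Omega>' s \<subseteq> candidates D s"
  shows "scenario_count \<Omega> < scenario_count \<Omega>'"
proof -
  have fin: "finite (\<Omega>' s)" for s
    using assms(3) finite_candidates finite_subset by blast
  obtain s where "\<Omega> s \<noteq> \<Omega>' s" using assms(2) by blast
  then have "card (\<Omega> s) < card (\<Omega>' s)"
    using fin assms(1) by (intro psubset_card_mono) auto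
  then show ?thesis
    unfolding scenario_count_def using fin assms(1)
    by (intro sum_strict_mono_ex1) (auto intro: card_mono)
qed

lemma cg_step_count_less:
  assumes "cg_reaches D x \<Omega>" "cg_step D x \<Omega> \<Omega>'"
  shows "scenario_count \<Omega> < scenario_count \<Omega>'"
  using cg_step_grows[OF assms(2)] cg_reaches_candidates[OF assms(1)]
  by (intro scenario_count_less) auto

text \<open>While the pricing master problem is infeasible, the sets of all candidates provide a step: they
  contain the samples, which makes the problem feasible, so they differ from the current sets.\<close>

lemma cg_progress:
  assumes x: "x \<in> first_stage D" and reach: "cg_reaches D x \<Omega>"
  shows "cg_stop D x \<Omega> \<or> (\<exists>\<Omega>'. cg_step D x \<Omega> \<Omega>')"
proof (cases "\<exists>p. pricing_master_feasible D \<Omega> p")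
  case True
  then obtain p where p: "pricing_master_feasible D \<Omega> p" by blast
  obtain \<alpha> \<beta> where m: "multipliers_optimal D x \<Omega> \<alpha> \<beta>"
    using optimal_multipliers_exist[OF p] by blast
  have "\<forall>s. \<exists>z. z \<in> candidates D s \<and> is_arg_max (reduced_cost D x \<alpha> \<beta> s) (\<lambda>\<xi>. \<xi> \<in> Xi D) z"
    using candidate_argmax[OF x] by blast
  from choice[OF this] obtain z
    where z: "\<forall>s. z s \<in> candidates D s \<and> is_arg_max (reduced_cost D x \<alpha> \<beta> s) (\<lambda>\<xi>. \<xi> \<in> Xi D) (z s)"
    by (elim exE)
  have priced: "cg_priced D x \<Omega> \<alpha> \<beta> z"
    using True m z by (simp add: cg_priced_def)
  show ?thesis
  proof (cases "\<exists>s. 0 < reduced_cost D x \<alpha> \<beta> s (z s)")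
    case True
    then show ?thesis using cg_step.price[OF priced] by blast
  next
    case False
    then show ?thesis using priced by (auto simp: cg_stop_def not_less)
  qed
next
  case False
  let ?\<Omega>' = "\<lambda>s. candidates D s"
  have "pricing_master_feasible D ?\<Omega>' (\<lambda>s \<xi>. of_bool (\<xi> = smp D s))"
  proof -
    have "(\<Sum>\<xi>\<in>candidates D s. g \<xi> * of_bool (\<xi> = smp D s)) = g (smp D s)" for s and g :: "_ \<Rightarrow> real"
      using finite_candidates[of s] sample_in_candidates[of s] by (simp add: of_bool_def if_distrib cong: if_cong)
    from this[of "\<lambda>_. 1"] this show ?thesis
      using radius by (simp add: pricing_master_feasible_def l1_def)
  qed
  then have "?\<Omega>' \<noteq> \<Omega>" using False by blast
  then have "cg_step D x \<Omega> ?\<Omega>'"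
    using False cg_reaches_candidates[OF reach] by (intro cg_step.phase1) auto
  then show ?thesis by blast
qed

text \<open>If the largest reduced cost over the box is nonpositive, the multipliers satisfy their constraints on
  the whole box. Their value is then an upper bound on \<open>v\<close>, and a primal solution of the same value is
  a lower bound.\<close>

lemma cg_stop_certificate:
  assumes x: "x \<in> first_stage D" and reach: "cg_reaches D x \<Omega>" and stop: "cg_stop D x \<Omega>"
  obtains \<alpha> \<beta> p where "multipliers_feasible D x (\<lambda>s. Xi D) \<alpha> \<beta>" "dual_value \<alpha> \<beta> = v D x"
    "pricing_master_feasible D \<Omega> p" "primal_value x \<Omega> p = v D x" "pricing_master_value D x \<Omega> = v D x"
proof -
  obtain \<alpha> \<beta> z where priced: "cg_priced D x \<Omega> \<alpha> \<beta> z" and nonpos: "\<And>s. reduced_cost D x \<alpha> \<beta> s (z s) \<le> 0"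
    using stop unfolding cg_stop_def by blast
  have m: "multipliers_optimal D x \<Omega> \<alpha> \<beta>"
    and amax: "\<And>s. is_arg_max (reduced_cost D x \<alpha> \<beta> s) (\<lambda>\<xi>. \<xi> \<in> Xi D) (z s)"
    using priced by (auto simp: cg_priced_def)
  have cand: "\<Omega> s \<subseteq> candidates D s" for s
    by (rule cg_reaches_candidates[OF reach])
  have fin: "finite (\<Omega> s)" for s
    by (rule finite_subset[OF cand finite_candidates])
  have sub: "\<Omega> s \<subseteq> Xi D" for s
    by (rule order_trans[OF cand candidates_subset_Xi])
  have "reduced_cost D x \<alpha> \<beta> s \<xi> \<le> 0" if "\<xi> \<in> Xi D" for s \<xi>
    using amax[of s] nonpos[of s] that unfolding is_arg_max_def by force
  then have mXi: "multipliers_feasible D x (\<lambda>s. Xi D) \<alpha> \<beta>"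
    using m by (auto simp: multipliers_optimal_def multipliers_feasible_def reduced_cost_def algebra_simps)
  obtain p where p: "pricing_master_feasible D \<Omega> p" "primal_value x \<Omega> p = dual_value \<alpha> \<beta>"
    using strong_duality[OF m fin] by blast
  have "dual_value \<alpha> \<beta> = v D x"
    using primal_value_le_v[OF x p(1) sub] v_le_dual_value[OF x mXi] p(2) by simp
  moreover have "pricing_master_value D x \<Omega> = dual_value \<alpha> \<beta>"
    by (rule pricing_master_value_eq_dual_value[OF m fin])
  ultimately show thesis
    using that[OF mXi _ p(1)] p(2) by simp
qed

lemma cg_terminates:
  assumes x: "x \<in> first_stage D"
  shows "\<exists>\<Omega>. cg_reaches D x \<Omega> \<and> cg_stop D x \<Omega>"
proof -
  have "\<exists>\<Omega>'. cg_reaches D x \<Omega>' \<and> cg_stop D x \<Omega>'" if "cg_reaches D x \<Omega>" for \<Omega>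
    using that
  proof (induction "3 ^ CARD('m) * CARD('s) - scenario_count \<Omega>" arbitrary: \<Omega> rule: less_induct)
    case less
    show ?case
    proof (cases "cg_stop D x \<Omega>")
      case False
      then obtain \<Omega>' where step: "cg_step D x \<Omega> \<Omega>'"
        using cg_progress[OF x less.prems] by blast
      have reach: "cg_reaches D x \<Omega>'"
        using less.prems step by (auto simp: cg_reaches_def)
      have "scenario_count \<Omega> < scenario_count \<Omega>'" by (rule cg_step_count_less[OF less.prems step])
      moreover have "scenario_count \<Omega>' \<le> 3 ^ CARD('m) * CARD('s)"
        by (intro scenario_count_le cg_reaches_candidates[OF reach])
      ultimately show ?thesis
        by (intro less.hyps[OF _ reach]) simp
    qed (use less.prems in blast)
  qed
  then show ?thesis by (auto simp: cg_reaches_def)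
qed

lemma cg_converges_first_stage:
  assumes x: "x \<in> first_stage D"
  shows "cg_converges D x"
  unfolding cg_converges_def
proof (intro conjI allI impI)
  show "\<nexists>\<omega>. \<omega> 0 = (\<lambda>s. {}) \<and> (\<forall>k::nat. cg_step D x (\<omega> k) (\<omega> (Suc k)))"
  proof
    assume "\<exists>\<omega>. \<omega> 0 = (\<lambda>s. {}) \<and> (\<forall>k::nat. cg_step D x (\<omega> k) (\<omega> (Suc k)))"
    then obtain \<omega> where \<omega>: "\<omega> 0 = (\<lambda>s. {})" "\<And>k::nat. cg_step D x (\<omega> k) (\<omega> (Suc k))" by blast
    have "cg_reaches D x (\<omega> k) \<and> k \<le> scenario_count (\<omega> k)" for k
    proof (induction k)
      case (Suc k)
      then have "scenario_count (\<omega> k) < scenario_count (\<omega> (Suc k))"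
        using cg_step_count_less \<omega>(2) by blast
      moreover have "cg_reaches D x (\<omega> (Suc k))"
        using Suc \<omega>(2)[of k] unfolding cg_reaches_def by (meson rtranclp.rtrancl_into_rtrancl)
      ultimately show ?case using Suc by simp
    qed (simp add: \<omega>(1) cg_reaches_def)
    from this[of "Suc (3 ^ CARD('m) * CARD('s))"] show False
      using scenario_count_le[of "\<omega> (Suc (3 ^ CARD('m) * CARD('s)))"] cg_reaches_candidates by fastforce
  qed
  show "cg_stop D x \<Omega> \<or> (\<exists>\<Omega>'. cg_step D x \<Omega> \<Omega>')" if "cg_reaches D x \<Omega>" for \<Omega>
    by (rule cg_progress[OF x that])
  show "pricing_master_value D x \<Omega> = v D x" if "cg_reaches D x \<Omega> \<and> cg_stop D x \<Omega>" for \<Omega>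
    using cg_stop_certificate[OF x] that by metis
qed

section \<open>The main master problem\<close>

text \<open>The multipliers that certify \<open>v D x\<close> satisfy the constraints of all scenarios of the box, so they
  are feasible for the main master problem with any scenario sets.\<close>

lemma main_master_relaxation:
  assumes x: "x \<in> first_stage D" and sub: "\<And>s. \<Upsilon> s \<subseteq> Xi D"
  shows "\<exists>\<alpha> \<beta> e y. main_master_feasible D \<Upsilon> x (v D x) \<alpha> \<beta> e y"
proof -
  obtain \<Omega> where \<Omega>: "cg_reaches D x \<Omega>" "cg_stop D x \<Omega>"
    using cg_terminates[OF x] by blast
  obtain \<alpha> \<beta> where m: "multipliers_feasible D x (\<lambda>s. Xi D) \<alpha> \<beta>" "dual_value \<alpha> \<beta> = v D x"
    by (rule cg_stop_certificate[OF x \<Omega>])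
  have "\<forall>\<xi>. \<exists>y. \<xi> \<in> Xi D \<longrightarrow> y \<in> recourse D x \<xi> \<and> Q D x \<xi> = dvec D \<bullet> y"
    using Q_attained[OF x] by blast
  from choice[OF this] obtain y
    where y: "\<forall>\<xi>. \<xi> \<in> Xi D \<longrightarrow> y \<xi> \<in> recourse D x \<xi> \<and> Q D x \<xi> = dvec D \<bullet> y \<xi>"
    by (elim exE)
  have "main_master_feasible D \<Upsilon> x (v D x) \<alpha> \<beta> (\<lambda>s. Q D x) (\<lambda>s. y)"
    unfolding main_master_feasible_def
  proof (intro conjI allI ballI)
    fix s \<xi> assume "\<xi> \<in> \<Upsilon> s"
    then have \<xi>: "\<xi> \<in> Xi D" using sub by blast
    then show "prb D s * Q D x \<xi> \<le> \<alpha> s + prb D s * l1 (\<xi> - smp D s) * \<beta>"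
      using m(1) by (simp add: multipliers_feasible_def)
    show "Q D x \<xi> = dvec D \<bullet> y \<xi>" "y \<xi> \<in> recourse D x \<xi>"
      using y \<xi> by blast+
  qed (use x m in \<open>simp_all add: multipliers_feasible_def dual_value_def\<close>)
  then show ?thesis by blast
qed

lemma main_master_optimal_le_opt_value:
  assumes "main_master_optimal D \<Upsilon> x w" and sub: "\<And>s. \<Upsilon> s \<subseteq> Xi D"
  shows "w \<le> opt_value D"
  unfolding opt_value_def
proof (rule cINF_greatest[OF feasible])
  fix x' assume "x' \<in> first_stage D"
  then obtain \<alpha> \<beta> e y where "main_master_feasible D \<Upsilon> x' (v D x') \<alpha> \<beta> e y"
    using main_master_relaxation[of x' \<Upsilon>] sub by blast
  then show "w \<le> total_cost D x'"
    using assms(1) unfolding main_master_optimal_def total_cost_def by blast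
qed

lemma primal_value_le_main_master:
  assumes mm: "main_master_feasible D \<Upsilon> x \<eta> \<alpha> \<beta> e y" and p: "pricing_master_feasible D \<Omega> p"
    and sub: "\<And>s. \<Omega> s \<subseteq> \<Upsilon> s" "\<And>s. \<Upsilon> s \<subseteq> Xi D"
  shows "primal_value x \<Omega> p \<le> \<eta>"
proof -
  have x: "x \<in> first_stage D" using mm by (simp add: main_master_feasible_def)
  have "prb D s * Q D x \<xi> \<le> \<alpha> s + prb D s * l1 (\<xi> - smp D s) * \<beta>" if "\<xi> \<in> \<Upsilon> s" for s \<xi>
  proof -
    have mm': "prb D s * e s \<xi> \<le> \<alpha> s + prb D s * l1 (\<xi> - smp D s) * \<beta>" "e s \<xi> = dvec D \<bullet> y s \<xi>"
        "y s \<xi> \<in> recourse D x \<xi>"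
      using mm that unfolding main_master_feasible_def by blast+
    have "prb D s * Q D x \<xi> \<le> prb D s * e s \<xi>"
      unfolding mm'(2) using mm'(3) that sub(2) prb_nonneg by (intro mult_left_mono Q_le[OF x]) auto
    with mm'(1) show ?thesis by simp
  qed
  then have "multipliers_feasible D x \<Omega> \<alpha> \<beta>"
    using mm sub(1) by (auto simp: multipliers_feasible_def main_master_feasible_def)
  from weak_duality[OF p this] show ?thesis
    using mm by (simp add: main_master_feasible_def dual_value_def)
qed

text \<open>The recourse change \<open>g\<close> along \<open>u\<close> works for all scenarios at once, and so raises the worst-case
  expectation at most at the rate \<open>dvec D \<bullet> g\<close>. If the sum below were negative, the total cost would be
  unbounded below on the ray.\<close>

lemma recession_cost_nonneg:
  fixes u :: "real ^ 'n" and g :: "real ^ 'y"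
  assumes x: "x \<in> first_stage D" and ray: "\<And>t. 0 \<le> t \<Longrightarrow> x + t *\<^sub>R u \<in> first_stage D"
    and g: "0 \<le> g" "Fmat D *v g \<le> - (Gmat D *v u)"
  shows "0 \<le> cvec D \<bullet> u + dvec D \<bullet> g"
proof -
  obtain m where m: "\<And>x. x \<in> first_stage D \<Longrightarrow> m \<le> total_cost D x"
    using bounded unfolding bdd_below_def by auto
  obtain \<Omega> where \<Omega>: "cg_reaches D x \<Omega>" "cg_stop D x \<Omega>"
    using cg_terminates[OF x] by blast
  obtain \<alpha> \<beta> where mf: "multipliers_feasible D x (\<lambda>s. Xi D) \<alpha> \<beta>" "dual_value \<alpha> \<beta> = v D x"
    by (rule cg_stop_certificate[OF x \<Omega>])
  have "m \<le> total_cost D x + t * (cvec D \<bullet> u + dvec D \<bullet> g)" if t: "0 \<le> t" for t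
  proof -
    let ?x = "x + t *\<^sub>R u"
    have Q_ray: "Q D ?x \<xi> \<le> Q D x \<xi> + t * (dvec D \<bullet> g)" if \<xi>: "\<xi> \<in> Xi D" for \<xi>
    proof -
      obtain y where y: "y \<in> recourse D x \<xi>" "Q D x \<xi> = dvec D \<bullet> y"
        using Q_attained[OF x \<xi>] by blast
      have "polyhedral {z. snd z \<in> recourse D (0 + fst z) \<xi>}
          {z. 0 \<le> snd z \<and> Fmat D *v snd z \<le> - (Gmat D *v fst z)}"
        by (rule polyhedral_recourse[OF linear_fst linear_snd])
      from polyhedral_recession[OF this, of "(x, y)" "(u, g)" t]
      have "y + t *\<^sub>R g \<in> recourse D ?x \<xi>"
        using y(1) g t by simp
      then have "Q D ?x \<xi> \<le> dvec D \<bullet> (y + t *\<^sub>R g)"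
        by (rule Q_le[OF ray[OF t] \<xi>])
      then show ?thesis using y(2) by (simp add: inner_add_right)
    qed
    have "multipliers_feasible D ?x (\<lambda>s. Xi D) (\<lambda>s. \<alpha> s + prb D s * (t * (dvec D \<bullet> g))) \<beta>"
      unfolding multipliers_feasible_def
    proof (intro conjI allI ballI)
      show "0 \<le> \<beta>" using mf by (simp add: multipliers_feasible_def)
      fix s \<xi> assume \<xi>: "\<xi> \<in> Xi D"
      have "prb D s * Q D ?x \<xi> \<le> prb D s * (Q D x \<xi> + t * (dvec D \<bullet> g))"
        by (rule mult_left_mono[OF Q_ray[OF \<xi>] prb_nonneg])
      moreover have "prb D s * Q D x \<xi> \<le> \<alpha> s + prb D s * l1 (\<xi> - smp D s) * \<beta>"
        using mf \<xi> by (simp add: multipliers_feasible_def)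
      ultimately show "prb D s * Q D ?x \<xi> \<le>
          \<alpha> s + prb D s * (t * (dvec D \<bullet> g)) + prb D s * l1 (\<xi> - smp D s) * \<beta>"
        by (simp add: distrib_left)
    qed
    from v_le_dual_value[OF ray[OF t] this]
    have "v D ?x \<le> v D x + t * (dvec D \<bullet> g)"
      using mf(2) by (simp add: dual_value_def sum.distrib prb_sum flip: sum_distrib_right)
    with m[OF ray[OF t]] show ?thesis
      by (simp add: total_cost_def inner_add_right distrib_left)
  qed
  then show ?thesis by (rule slope_nonneg)
qed

text \<open>The main master problem restricted to a fixed choice \<open>B\<close> of the binary variables with value
  \<open>1\<close>, which makes it a linear program. The variables \<open>\<eta>\<close> and \<open>\<eta>\<^sub>\<xi>\<close> are eliminated.\<close>

definition master_points :: "('s \<Rightarrow> (real ^ 'm) set) \<Rightarrow> 'n set \<Rightarrow>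
    ((real ^ 'n) \<times> ('s \<Rightarrow> real) \<times> real \<times> ('s \<Rightarrow> real ^ 'm \<Rightarrow> real ^ 'y)) set" where
  "master_points \<Upsilon> B = {(x, \<alpha>, \<beta>, y). Amat D *v x \<le> bvec D \<and> 0 \<le> x \<and>
     (\<forall>j\<in>bin D. x $ j = of_bool (j \<in> B)) \<and> 0 \<le> \<beta> \<and>
     (\<forall>s. \<forall>\<xi>\<in>\<Upsilon> s. prb D s * (dvec D \<bullet> y s \<xi>) \<le> \<alpha> s + prb D s * l1 (\<xi> - smp D s) * \<beta> \<and>
        y s \<xi> \<in> recourse D x \<xi>)}"

definition master_directions :: "('s \<Rightarrow> (real ^ 'm) set) \<Rightarrow>
    ((real ^ 'n) \<times> ('s \<Rightarrow> real) \<times> real \<times> ('s \<Rightarrow> real ^ 'm \<Rightarrow> real ^ 'y)) set" where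
  "master_directions \<Upsilon> = {(u, \<alpha>, \<beta>, g). Amat D *v u \<le> 0 \<and> 0 \<le> u \<and>
     (\<forall>j\<in>bin D. u $ j = 0) \<and> 0 \<le> \<beta> \<and>
     (\<forall>s. \<forall>\<xi>\<in>\<Upsilon> s. prb D s * (dvec D \<bullet> g s \<xi>) \<le> \<alpha> s + prb D s * l1 (\<xi> - smp D s) * \<beta> \<and>
        0 \<le> g s \<xi> \<and> Fmat D *v g s \<xi> \<le> - (Gmat D *v u))}"

lemma polyhedral_master_points:
  assumes fin: "\<And>s. finite (\<Upsilon> s)"
  shows "polyhedral (master_points \<Upsilon> B) (master_directions \<Upsilon>)"
proof -
  have lin: "linear (\<lambda>z :: (real ^ 'n) \<times> ('s \<Rightarrow> real) \<times> real \<times> ('s \<Rightarrow> real ^ 'm \<Rightarrow> real ^ 'y). fst z $ j)"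
    "linear (\<lambda>z :: (real ^ 'n) \<times> ('s \<Rightarrow> real) \<times> real \<times> ('s \<Rightarrow> real ^ 'm \<Rightarrow> real ^ 'y). fst (snd (snd z)))"
    "linear (\<lambda>z :: (real ^ 'n) \<times> ('s \<Rightarrow> real) \<times> real \<times> ('s \<Rightarrow> real ^ 'm \<Rightarrow> real ^ 'y). Amat D *v fst z)"
    "linear (\<lambda>z :: (real ^ 'n) \<times> ('s \<Rightarrow> real) \<times> real \<times> ('s \<Rightarrow> real ^ 'm \<Rightarrow> real ^ 'y).
       k * (dvec D \<bullet> snd (snd (snd z)) s \<xi>))"
    "linear (\<lambda>z :: (real ^ 'n) \<times> ('s \<Rightarrow> real) \<times> real \<times> ('s \<Rightarrow> real ^ 'm \<Rightarrow> real ^ 'y).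
       fst (snd z) s + k * fst (snd (snd z)))"
    "linear (\<lambda>z :: (real ^ 'n) \<times> ('s \<Rightarrow> real) \<times> real \<times> ('s \<Rightarrow> real ^ 'm \<Rightarrow> real ^ 'y). snd (snd (snd z)) s \<xi>)"
    for j k s \<xi>
    by (intro linearI;
        simp add: matrix_vector_right_distrib matrix_vector_mult_scaleR inner_add_right distrib_left)+
  have points: "master_points \<Upsilon> B =
      {z. Amat D *v fst z \<le> 0 + bvec D} \<inter> ({z. 0 \<le> fst z + 0} \<inter>
      ((\<Inter>j\<in>bin D. {z. fst z $ j = of_bool (j \<in> B)}) \<inter> ({z. 0 \<le> fst (snd (snd z)) + 0} \<inter>
      (\<Inter>s\<in>UNIV. \<Inter>\<xi>\<in>\<Upsilon> s. {z. prb D s * (dvec D \<bullet> snd (snd (snd z)) s \<xi>)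
          \<le> (fst (snd z) s + prb D s * l1 (\<xi> - smp D s) * fst (snd (snd z))) + 0} \<inter>
        {z. snd (snd (snd z)) s \<xi> \<in> recourse D (0 + fst z) \<xi>}))))"
    by (auto simp: master_points_def)
  have directions: "master_directions \<Upsilon> =
      {z. Amat D *v fst z \<le> 0} \<inter> ({z. 0 \<le> fst z} \<inter>
      ((\<Inter>j\<in>bin D. {z. fst z $ j = 0}) \<inter> ({z. 0 \<le> fst (snd (snd z))} \<inter>
      (\<Inter>s\<in>UNIV. \<Inter>\<xi>\<in>\<Upsilon> s. {z. prb D s * (dvec D \<bullet> snd (snd (snd z)) s \<xi>)
          \<le> fst (snd z) s + prb D s * l1 (\<xi> - smp D s) * fst (snd (snd z))} \<inter>
        {z. 0 \<le> snd (snd (snd z)) s \<xi> \<and> Fmat D *v snd (snd (snd z)) s \<xi> \<le> - (Gmat D *v fst z)}))))"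
    by (auto simp: master_directions_def)
  show ?thesis
    unfolding points directions using fin
    by (intro polyhedral_Int polyhedral_INT polyhedral_vec_le[OF lin(3) linear_zero]
        polyhedral_vec_le[OF linear_zero linear_fst] polyhedral_eq[OF lin(1)]
        polyhedral_le[OF linear_zero lin(2)] polyhedral_le[OF lin(4) lin(5)]
        polyhedral_recourse[OF linear_fst lin(6)]) auto
qed

lemma first_stage_of_master_point:
  assumes "(x, \<alpha>, \<beta>, y) \<in> master_points \<Upsilon> B"
  shows "x \<in> first_stage D"
  using assms unfolding master_points_def first_stage_def by (auto simp: less_eq_vec_def of_bool_def)

text \<open>The average of the recourse changes with the weights of a feasible pricing solution is a
  recourse change for \<open>u\<close>, and by weak duality it costs at most as much as the multiplier part of the
  direction.\<close>

lemma master_direction_cost_nonneg: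
  assumes p: "pricing_master_feasible D \<Upsilon> p"
    and point: "(x, \<alpha>, \<beta>, y) \<in> master_points \<Upsilon> B"
    and dir: "(u, a, b, g) \<in> master_directions \<Upsilon>"
  shows "0 \<le> cvec D \<bullet> u + dual_value a b"
proof -
  note fin = pricing_master_feasible_finite(1)[OF p]
  have p0: "\<And>s \<xi>. \<xi> \<in> \<Upsilon> s \<Longrightarrow> 0 \<le> p s \<xi>" and p1: "\<And>s. (\<Sum>\<xi>\<in>\<Upsilon> s. p s \<xi>) = 1"
    using p by (auto simp: pricing_master_feasible_def)
  have g: "\<And>s \<xi>. \<xi> \<in> \<Upsilon> s \<Longrightarrow> 0 \<le> g s \<xi>" "\<And>s \<xi>. \<xi> \<in> \<Upsilon> s \<Longrightarrow> Fmat D *v g s \<xi> \<le> - (Gmat D *v u)"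
    and b: "0 \<le> b" and le: "\<And>s \<xi>. \<xi> \<in> \<Upsilon> s \<Longrightarrow>
      prb D s * (dvec D \<bullet> g s \<xi>) \<le> a s + prb D s * l1 (\<xi> - smp D s) * b"
    using dir by (auto simp: master_directions_def)
  define mean where "mean = (\<Sum>s\<in>UNIV. \<Sum>\<xi>\<in>\<Upsilon> s. (prb D s * p s \<xi>) *\<^sub>R g s \<xi>)"
  have weight: "0 \<le> prb D s * p s \<xi>" if "\<xi> \<in> \<Upsilon> s" for s \<xi>
    using p0[OF that] prb_nonneg by simp
  have weights: "(\<Sum>s\<in>UNIV. \<Sum>\<xi>\<in>\<Upsilon> s. prb D s * p s \<xi>) = 1"
    by (simp add: p1 prb_sum flip: sum_distrib_left)
  have "0 \<le> mean"
    unfolding mean_def using g(1) weight by (intro sum_nonneg scaleR_nonneg_nonneg) auto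
  moreover have "Fmat D *v mean \<le> - (Gmat D *v u)"
  proof -
    have "Fmat D *v mean = (\<Sum>s\<in>UNIV. \<Sum>\<xi>\<in>\<Upsilon> s. (prb D s * p s \<xi>) *\<^sub>R (Fmat D *v g s \<xi>))"
      unfolding mean_def
      by (simp add: linear_sum[OF matrix_vector_mul_linear] matrix_vector_mult_scaleR)
    also have "\<dots> \<le> (\<Sum>s\<in>UNIV. \<Sum>\<xi>\<in>\<Upsilon> s. (prb D s * p s \<xi>) *\<^sub>R - (Gmat D *v u))"
      using g(2) weight by (intro sum_mono scaleR_left_mono) auto
    also have "\<dots> = (\<Sum>s\<in>UNIV. \<Sum>\<xi>\<in>\<Upsilon> s. prb D s * p s \<xi>) *\<^sub>R - (Gmat D *v u)"
      by (simp only: scaleR_left.sum)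
    also have "\<dots> = - (Gmat D *v u)" by (simp add: weights)
    finally show ?thesis .
  qed
  moreover have "x + t *\<^sub>R u \<in> first_stage D" if "0 \<le> t" for t
  proof -
    have "(x, \<alpha>, \<beta>, y) + t *\<^sub>R (u, a, b, g) \<in> master_points \<Upsilon> B"
      by (rule polyhedral_recession[OF polyhedral_master_points[OF fin] point dir that])
    then show ?thesis
      by (auto intro: first_stage_of_master_point)
  qed
  ultimately have "0 \<le> cvec D \<bullet> u + dvec D \<bullet> mean"
    using first_stage_of_master_point[OF point] by (intro recession_cost_nonneg[of x])
  moreover have "dvec D \<bullet> mean = (\<Sum>s\<in>UNIV. \<Sum>\<xi>\<in>\<Upsilon> s. prb D s * (dvec D \<bullet> g s \<xi>) * p s \<xi>)"
    by (simp add: mean_def inner_sum_right mult_ac)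
  moreover have "\<dots> \<le> dual_value a b"
    by (rule weighted_values_le_dual_value[OF p b le])
  ultimately show ?thesis by simp
qed

text \<open>One linear program for each of the finitely many binary patterns; the best of their optima is
  optimal.\<close>

lemma main_master_attains:
  assumes p: "pricing_master_feasible D \<Upsilon> p" and sub: "\<And>s. \<Upsilon> s \<subseteq> Xi D"
  shows "\<exists>x w. main_master_optimal D \<Upsilon> x w"
proof -
  note fin = pricing_master_feasible_finite(1)[OF p]
  define c where "c = (\<lambda>z :: (real ^ 'n) \<times> ('s \<Rightarrow> real) \<times> real \<times> ('s \<Rightarrow> real ^ 'm \<Rightarrow> real ^ 'y).
    cvec D \<bullet> fst z + dual_value (fst (snd z)) (fst (snd (snd z))))"
  have lin: "linear c"
    unfolding c_def dual_value_def
    by (intro linearI) (simp_all add: inner_add_right sum.distrib sum_distrib_left algebra_simps)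
  define patterns where "patterns = {B. B \<subseteq> bin D \<and> master_points \<Upsilon> B \<noteq> {}}"
  have "\<exists>z\<in>master_points \<Upsilon> B. \<forall>z'\<in>master_points \<Upsilon> B. c z \<le> c z'" if "B \<in> patterns" for B
  proof (rule linear_program_attains[OF polyhedral_master_points[OF fin] _ lin])
    show "master_points \<Upsilon> B \<noteq> {}" using that by (simp add: patterns_def)
    then obtain x \<alpha> \<beta> y where "(x, \<alpha>, \<beta>, y) \<in> master_points \<Upsilon> B" by auto
    then show "0 \<le> c u" if "u \<in> master_directions \<Upsilon>" for u
      using master_direction_cost_nonneg[OF p] that by (cases u) (auto simp: c_def)
  qed
  then have "\<forall>B. \<exists>z. B \<in> patterns \<longrightarrow> z \<in> master_points \<Upsilon> B \<and> (\<forall>z'\<in>master_points \<Upsilon> B. c z \<le> c z')"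
    by blast
  from choice[OF this] obtain best where best: "\<forall>B. B \<in> patterns \<longrightarrow>
      best B \<in> master_points \<Upsilon> B \<and> (\<forall>z'\<in>master_points \<Upsilon> B. c (best B) \<le> c z')"
    by (elim exE)
  have to_point: "(x, \<alpha>, \<beta>, y) \<in> master_points \<Upsilon> {j\<in>bin D. x $ j = 1}"
    if mm: "main_master_feasible D \<Upsilon> x \<eta> \<alpha> \<beta> e y" for x \<eta> \<alpha> \<beta> e y
  proof -
    have "x \<in> first_stage D" using mm by (simp add: main_master_feasible_def)
    then have "Amat D *v x \<le> bvec D" and bin: "\<forall>j\<in>bin D. x $ j \<in> {0, 1}"
      and cont: "\<forall>j\<in>- bin D. 0 \<le> x $ j"
      by (auto simp: first_stage_def)
    moreover have "0 \<le> x"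
      unfolding less_eq_vec_def
    proof
      fix j show "(0 :: real ^ 'n) $ j \<le> x $ j"
        using bin cont by (cases "j \<in> bin D") force+
    qed
    moreover have "\<forall>j\<in>bin D. x $ j = of_bool (j \<in> {j\<in>bin D. x $ j = 1})"
      using bin by auto
    moreover have "prb D s * (dvec D \<bullet> y s \<xi>) \<le> \<alpha> s + prb D s * l1 (\<xi> - smp D s) * \<beta> \<and>
        y s \<xi> \<in> recourse D x \<xi>" if "\<xi> \<in> \<Upsilon> s" for s \<xi>
    proof -
      have "prb D s * e s \<xi> \<le> \<alpha> s + prb D s * l1 (\<xi> - smp D s) * \<beta>" "e s \<xi> = dvec D \<bullet> y s \<xi>"
          "y s \<xi> \<in> recourse D x \<xi>"
        using mm that unfolding main_master_feasible_def by blast+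
      then show ?thesis by simp
    qed
    moreover have "0 \<le> \<beta>" using mm unfolding main_master_feasible_def by blast
    ultimately show ?thesis
      unfolding master_points_def by blast
  qed
  have "finite patterns" by (rule finite_subset[of _ "Pow (bin D)"]) (auto simp: patterns_def)
  moreover have "patterns \<noteq> {}"
  proof -
    obtain x where "x \<in> first_stage D" using feasible by blast
    then obtain \<alpha> \<beta> e y where "main_master_feasible D \<Upsilon> x (v D x) \<alpha> \<beta> e y"
      using main_master_relaxation[of x \<Upsilon>] sub by blast
    then have "master_points \<Upsilon> {j\<in>bin D. x $ j = 1} \<noteq> {}" using to_point by blast
    then have "{j\<in>bin D. x $ j = 1} \<in> patterns" by (simp add: patterns_def)
    then show ?thesis by blast
  qed
  ultimately have fin_vals: "finite ((\<lambda>B. c (best B)) ` patterns)"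
    and "Min ((\<lambda>B. c (best B)) ` patterns) \<in> (\<lambda>B. c (best B)) ` patterns"
    by (auto intro: Min_in)
  then obtain B where B: "B \<in> patterns" "c (best B) = Min ((\<lambda>B. c (best B)) ` patterns)" by auto
  obtain x \<alpha> \<beta> y where z: "best B = (x, \<alpha>, \<beta>, y)" by (cases "best B")
  have point: "(x, \<alpha>, \<beta>, y) \<in> master_points \<Upsilon> B" using best B(1) z by metis
  have "main_master_feasible D \<Upsilon> x (dual_value \<alpha> \<beta>) \<alpha> \<beta> (\<lambda>s \<xi>. dvec D \<bullet> y s \<xi>) y"
    using point first_stage_of_master_point[OF point]
    by (auto simp: master_points_def main_master_feasible_def dual_value_def)
  moreover have "c (best B) = cvec D \<bullet> x + dual_value \<alpha> \<beta>" by (simp add: z c_def)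
  moreover have "c (best B) \<le> cvec D \<bullet> x' + \<eta>'" if mm: "main_master_feasible D \<Upsilon> x' \<eta>' \<alpha>' \<beta>' e' y'"
    for x' \<eta>' \<alpha>' \<beta>' e' y'
  proof -
    let ?B = "{j\<in>bin D. x' $ j = 1}"
    have pt: "(x', \<alpha>', \<beta>', y') \<in> master_points \<Upsilon> ?B" by (rule to_point[OF mm])
    then have "?B \<in> patterns" by (auto simp: patterns_def)
    then have "c (best B) \<le> c (best ?B)" unfolding B(2) using fin_vals by (intro Min_le) auto
    also have "\<dots> \<le> c (x', \<alpha>', \<beta>', y')" using best \<open>?B \<in> patterns\<close> pt by blast
    also have "\<dots> \<le> cvec D \<bullet> x' + \<eta>'"
      using mm by (simp add: c_def main_master_feasible_def dual_value_def)
    finally show ?thesis .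
  qed
  ultimately show ?thesis
    unfolding main_master_optimal_def by (intro exI[of _ x] exI[of _ "c (best B)"]) blast
qed

section \<open>The outer algorithm\<close>

lemma opt_value_le:
  assumes "x \<in> first_stage D"
  shows "opt_value D \<le> total_cost D x"
  unfolding opt_value_def by (rule cINF_lower[OF bounded assms])

text \<open>For \<open>l = 0\<close> this relies on division by zero in \<^typ>\<open>ereal\<close>, where the sign of the numerator
  decides.\<close>

lemma ccg_stop_iff:
  fixes st :: "('n, 'm, 's) ccg_state"
  assumes "LB st = ereal l" "UB st = ereal u"
  shows "ccg_stop 0 st \<longleftrightarrow> u \<le> l"
proof (cases "l = 0")
  case True
  have "ereal u / 0 \<le> 0 \<longleftrightarrow> u \<le> 0"
    by (cases "u = 0") (auto simp: divide_ereal_def)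
  then show ?thesis
    using assms True by (simp add: ccg_stop_def zero_ereal_def)
next
  case False
  then show ?thesis
    using assms by (simp add: ccg_stop_def divide_le_0_iff)
qed

text \<open>Holds after each iteration, the opening pass included. A feasible pricing problem keeps the main
  master problem from being unbounded, and the candidates bound the number of scenarios.\<close>

definition sound_state :: "('n, 'm, 's) ccg_state \<Rightarrow> bool" where
  "sound_state st \<longleftrightarrow> (\<forall>s. scenarios st s \<subseteq> candidates D s) \<and>
     (\<exists>p. pricing_master_feasible D (scenarios st) p) \<and> LB st \<le> ereal (opt_value D) \<and>
     (\<exists>x\<in>first_stage D. incumbent st = Some x \<and> UB st = ereal (total_cost D x))"

lemma solve_main_master_cases:
  assumes "solve_main_master D \<Upsilon> x lb" "\<And>s. \<Upsilon> s \<subseteq> Xi D"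
  shows "x \<in> first_stage D" "lb \<le> ereal (opt_value D)"
proof -
  have "x \<in> first_stage D \<and> lb \<le> ereal (opt_value D)"
    using assms(1)
  proof cases
    case (optimal w)
    then show ?thesis
      using main_master_optimal_le_opt_value[of \<Upsilon> x w] assms(2)
      by (auto simp: main_master_optimal_def main_master_feasible_def)
  qed simp
  then show "x \<in> first_stage D" "lb \<le> ereal (opt_value D)" by auto
qed

lemma ccg_iteration_exists:
  assumes "solve_main_master D (scenarios st) x lb" "x \<in> first_stage D"
  shows "\<exists>st'. ccg_iteration D st st'"
proof -
  obtain \<Omega> where "cg_reaches D x \<Omega>" "cg_stop D x \<Omega>"
    using cg_terminates[OF assms(2)] by blast
  from ccg_iteration.intros[OF assms(1) this refl] show ?thesis by blast
qed

text \<open>The last claim carries the convergence. If the iteration adds no scenario, the certificate of the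
  inner procedure lies within the scenarios of the master problem just solved, whose value is then
  no smaller than the total cost of the first-stage solution. The assumption on the upper bound is
  met by the initial state and by sound states.\<close>

lemma ccg_iteration_sound:
  assumes it: "ccg_iteration D st st'"
    and cand: "\<And>s. scenarios st s \<subseteq> candidates D s"
    and ub: "UB st = \<infinity> \<or> (\<exists>x\<in>first_stage D. incumbent st = Some x \<and> UB st = ereal (total_cost D x))"
  shows "sound_state st'"
    and "\<And>s. scenarios st s \<subseteq> scenarios st' s"
    and "sound_state st \<Longrightarrow> scenarios st' = scenarios st \<Longrightarrow> ccg_stop 0 st'"
proof -
  obtain x lb \<Omega> where sol: "solve_main_master D (scenarios st) x lb"
    and reach: "cg_reaches D x \<Omega>" and stop: "cg_stop D x \<Omega>"
    and scen: "scenarios st' = (\<lambda>s. scenarios st s \<union> \<Omega> s)" and lb: "LB st' = lb"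
    and ub': "UB st' = min (UB st) (ereal (cvec D \<bullet> x + pricing_master_value D x \<Omega>))"
    and inc': "incumbent st' = (if ereal (cvec D \<bullet> x + pricing_master_value D x \<Omega>) < UB st
      then Some x else incumbent st)"
    using it by (elim ccg_iteration.cases) auto
  have Xi: "scenarios st s \<subseteq> Xi D" for s
    using cand candidates_subset_Xi by blast
  have x: "x \<in> first_stage D" and lb_opt: "lb \<le> ereal (opt_value D)"
    using solve_main_master_cases[OF sol] Xi by blast+
  obtain \<alpha> \<beta> p where p: "pricing_master_feasible D \<Omega> p" "primal_value x \<Omega> p = v D x"
      "pricing_master_value D x \<Omega> = v D x"
    by (rule cg_stop_certificate[OF x reach stop])
  have u: "cvec D \<bullet> x + pricing_master_value D x \<Omega> = total_cost D x"
    by (simp add: p(3) total_cost_def)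
  have cand': "scenarios st' s \<subseteq> candidates D s" for s
    using cand cg_reaches_candidates[OF reach] by (simp add: scen)
  have "finite (scenarios st' s)" for s
    by (rule finite_subset[OF cand' finite_candidates])
  then have "pricing_master_feasible D (scenarios st') (\<lambda>s \<xi>. if \<xi> \<in> \<Omega> s then p s \<xi> else 0)"
    by (intro pricing_master_feasible_mono[OF p(1)]) (auto simp: scen)
  moreover have "\<exists>x\<in>first_stage D. incumbent st' = Some x \<and> UB st' = ereal (total_cost D x)"
    using ub x unfolding ub' inc' u by (auto simp: min_def not_le not_less)
  ultimately show "sound_state st'"
    using cand' lb_opt by (auto simp: sound_state_def lb)
  show "scenarios st s \<subseteq> scenarios st' s" for s by (simp add: scen)
  assume sound: "sound_state st" and same: "scenarios st' = scenarios st"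
  have sub: "\<Omega> s \<subseteq> scenarios st s" for s
    using same scen by (metis Un_upper2)
  obtain x0 w0 where opt0: "main_master_optimal D (scenarios st) x0 w0"
    using sound main_master_attains[of "scenarios st"] Xi unfolding sound_state_def by blast
  from sol show "ccg_stop 0 st'"
  proof cases
    case (optimal w)
    then obtain \<eta> \<alpha>' \<beta>' e y where mm: "main_master_feasible D (scenarios st) x \<eta> \<alpha>' \<beta>' e y"
        and w: "w = cvec D \<bullet> x + \<eta>"
      unfolding main_master_optimal_def by blast
    have "v D x \<le> \<eta>"
      using primal_value_le_main_master[OF mm p(1) sub Xi] by (simp add: p(2))
    then have "total_cost D x \<le> w" by (simp add: w total_cost_def)
    moreover obtain x1 where "UB st' = ereal (total_cost D x1)"
      using \<open>sound_state st'\<close> unfolding sound_state_def by blast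
    moreover have "UB st' \<le> ereal (total_cost D x)" by (simp add: ub' u)
    ultimately show ?thesis
      using optimal by (subst ccg_stop_iff[of _ w "total_cost D x1"]) (auto simp: lb)
  next
    case unbounded
    then obtain x' \<eta>' \<alpha>' \<beta>' e' y' where "main_master_feasible D (scenarios st) x' \<eta>' \<alpha>' \<beta>' e' y'"
        "cvec D \<bullet> x' + \<eta>' < w0"
      unfolding main_master_unbounded_def by blast
    moreover from this(1) have "w0 \<le> cvec D \<bullet> x' + \<eta>'"
      using opt0 unfolding main_master_optimal_def by blast
    ultimately show ?thesis by simp
  qed
qed

text \<open>On empty scenario sets the multipliers \<open>\<alpha>\<close> can be lowered without limit.\<close>

lemma first_iteration_exists: "\<exists>st. ccg_iteration D initial_state st"
proof -
  obtain x where x: "x \<in> first_stage D" using feasible by blast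
  have "main_master_unbounded D (\<lambda>s. {})"
    unfolding main_master_unbounded_def
  proof
    fix B
    \<comment> \<open>The multipliers \<open>\<alpha>\<close> share \<open>\<eta>\<close> equally, so that their sum is \<open>\<eta>\<close>.\<close>
    let ?\<eta> = "B - 1 - cvec D \<bullet> x"
    have "main_master_feasible D (\<lambda>s. {}) x ?\<eta> (\<lambda>s. ?\<eta> / real CARD('s)) 0 e y" for e y
      using x by (simp add: main_master_feasible_def)
    moreover have "cvec D \<bullet> x + ?\<eta> < B" by simp
    ultimately show "\<exists>x \<eta> \<alpha> \<beta> e y. main_master_feasible D (\<lambda>s. {}) x \<eta> \<alpha> \<beta> e y \<and> cvec D \<bullet> x + \<eta> < B"
      by blast
  qed
  then have "solve_main_master D (scenarios initial_state) x (-\<infinity>)"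
    using x by (simp add: initial_state_def solve_main_master.unbounded)
  then show ?thesis using ccg_iteration_exists x by blast
qed

lemma card_le_scenario_count:
  assumes "pricing_master_feasible D \<Upsilon> p"
  shows "CARD('s) \<le> scenario_count \<Upsilon>"
proof -
  have "1 \<le> card (\<Upsilon> s)" for s
    using pricing_master_feasible_finite[OF assms, of s] by (simp add: Suc_le_eq card_gt_0_iff)
  then have "(\<Sum>s\<in>(UNIV :: 's set). 1) \<le> scenario_count \<Upsilon>"
    unfolding scenario_count_def by (intro sum_mono)
  then show ?thesis by simp
qed

text \<open>The opening pass leaves at least \<open>CARD('s)\<close> scenarios, and each later iteration that does
  not end the algorithm adds one. An iteration that ends it may add none, which is why the bound on
  \<open>k\<close> exceeds by one what the number of candidates alone would give.\<close>

lemma ccg_after_invariant: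
  assumes "ccg_after D 0 k st"
  shows "sound_state st \<and> k + CARD('s) \<le> Suc (3 ^ CARD('m) * CARD('s)) \<and>
    (\<not> ccg_stop 0 st \<longrightarrow> k + CARD('s) \<le> scenario_count (scenarios st))"
  using assms
proof (induction rule: ccg_after.induct)
  case (first st)
  have "sound_state st"
    by (rule ccg_iteration_sound(1)[OF first]) (auto simp: initial_state_def)
  then have "CARD('s) \<le> scenario_count (scenarios st)"
    using card_le_scenario_count unfolding sound_state_def by blast
  moreover have "CARD('s) \<le> 3 ^ CARD('m) * CARD('s)" by simp
  ultimately show ?case using \<open>sound_state st\<close> by (simp del: mult_le_cancel2 add: le_SucI)
next
  case (further k st st')
  then have sound: "sound_state st" and size: "k + CARD('s) \<le> scenario_count (scenarios st)" by auto
  have cand: "scenarios st s \<subseteq> candidates D s" for s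
    using sound by (simp add: sound_state_def)
  have ub: "UB st = \<infinity> \<or> (\<exists>x\<in>first_stage D. incumbent st = Some x \<and> UB st = ereal (total_cost D x))"
    using sound by (simp add: sound_state_def)
  note it = ccg_iteration_sound[OF further.hyps(3) cand ub]
  have "k + CARD('s) \<le> 3 ^ CARD('m) * CARD('s)"
    using size scenario_count_le[OF cand] by simp
  moreover have "Suc k + CARD('s) \<le> scenario_count (scenarios st')" if "\<not> ccg_stop 0 st'"
  proof -
    have "scenarios st \<noteq> scenarios st'" using it(3)[OF sound] that by metis
    then have "scenario_count (scenarios st) < scenario_count (scenarios st')"
      using it(1,2) by (intro scenario_count_less) (auto simp: sound_state_def)
    with size show ?thesis by simp
  qed
  ultimately show ?case using it(1) by simp
qed

lemma sound_state_stop_optimal: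
  assumes sound: "sound_state st" and stop: "ccg_stop 0 st"
  shows "LB st = ereal (opt_value D) \<and> UB st = ereal (opt_value D) \<and>
    (\<exists>x. incumbent st = Some x \<and> global_optimum D x \<and> total_cost D x = opt_value D)"
proof -
  obtain x where x: "x \<in> first_stage D" "incumbent st = Some x" "UB st = ereal (total_cost D x)"
    and lb: "LB st \<le> ereal (opt_value D)"
    using sound unfolding sound_state_def by blast
  have "LB st \<noteq> -\<infinity>" using stop by (simp add: ccg_stop_def)
  with lb obtain l where l: "LB st = ereal l" by (cases "LB st") auto
  have "total_cost D x \<le> l" using ccg_stop_iff[OF l x(3)] stop by simp
  moreover have "l \<le> opt_value D" using lb l by simp
  ultimately have eq: "total_cost D x = opt_value D" "l = opt_value D"
    using opt_value_le[OF x(1)] by simp_all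
  then have "global_optimum D x"
    using x(1) opt_value_le by (simp add: global_optimum_def)
  with x l eq show ?thesis by simp
qed

lemma sound_state_next_iteration:
  assumes "sound_state st"
  shows "\<exists>st'. ccg_iteration D st st'"
proof -
  have Xi: "scenarios st s \<subseteq> Xi D" for s
    using assms candidates_subset_Xi unfolding sound_state_def by blast
  obtain x w where "main_master_optimal D (scenarios st) x w"
    using assms main_master_attains[of "scenarios st"] Xi unfolding sound_state_def by blast
  then have "solve_main_master D (scenarios st) x (ereal w)" by (rule solve_main_master.optimal)
  moreover have "x \<in> first_stage D" by (rule solve_main_master_cases(1)[OF calculation Xi])
  ultimately show ?thesis by (rule ccg_iteration_exists)
qed

end

theorem corollary3:
  fixes D :: "('n::finite, 'm::finite, 'y::finite, 'p::finite, 'q::finite, 's::finite) dro"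
  assumes salg: "sigma_algebra (Xi D) (salg D)"
    and borel: "sets (restrict_space borel (Xi D)) \<subseteq> salg D"
    and samples: "\<And>s. smp D s \<in> Xi D"
    and prb_nonneg: "\<And>s. 0 \<le> prb D s"
    and prb_sum: "(\<Sum>s\<in>UNIV. prb D s) = 1"
    and radius: "0 \<le> radius D"
    and recourse: "relatively_complete_recourse D"
    and feasible: "first_stage D \<noteq> {}"
    and bounded: "bdd_below (total_cost D ` first_stage D)"
  shows "(\<forall>x\<in>first_stage D. cg_converges D x) \<and>
    (\<exists>st. ccg_iteration D initial_state st) \<and>
    (\<forall>k st. ccg_after D 0 k st \<longrightarrow>
       k \<le> 3 ^ CARD('m) * CARD('s) \<and>
       (2 \<le> CARD('s) \<longrightarrow> Suc k \<le> 3 ^ CARD('m) * CARD('s)) \<and>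
       (if ccg_stop 0 st
        then LB st = ereal (opt_value D) \<and> UB st = ereal (opt_value D) \<and>
             (\<exists>x. incumbent st = Some x \<and> global_optimum D x \<and> total_cost D x = opt_value D)
        else \<exists>st'. ccg_iteration D st st'))"
proof -
  interpret dro_instance D
    by (rule dro_instance.intro) (fact salg borel samples prb_nonneg prb_sum radius recourse feasible bounded)+
  have "k \<le> 3 ^ CARD('m) * CARD('s) \<and>
       (2 \<le> CARD('s) \<longrightarrow> Suc k \<le> 3 ^ CARD('m) * CARD('s)) \<and>
       (if ccg_stop 0 st
        then LB st = ereal (opt_value D) \<and> UB st = ereal (opt_value D) \<and>
             (\<exists>x. incumbent st = Some x \<and> global_optimum D x \<and> total_cost D x = opt_value D)
        else \<exists>st'. ccg_iteration D st st')" if "ccg_after D 0 k st" for k st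
  proof -
    have sound: "sound_state st" and k: "k + CARD('s) \<le> Suc (3 ^ CARD('m) * CARD('s))"
      using ccg_after_invariant[OF that] by auto
    have "0 < CARD('s)" by simp
    with k have "k \<le> 3 ^ CARD('m) * CARD('s)" by linarith
    moreover have "2 \<le> CARD('s) \<longrightarrow> Suc k \<le> 3 ^ CARD('m) * CARD('s)"
      using k by linarith
    ultimately show ?thesis
      using sound_state_stop_optimal[OF sound] sound_state_next_iteration[OF sound] by simp
  qed
  then show ?thesis
    using cg_converges_first_stage first_iteration_exists by blast
qed

end
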